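(* Let $n>2$, $0<r<1$, $D=\{x\in\mathbb{D}^n:|x|<r\}$ and $\rho=\frac{n-2}{2}$. Let $X(t)$ be the hyperbolic Brownian motion on $\mathbb{D}^n$ started at $x\ne0$ with $|x|<r$, let $\tau_D=\inf\{t\ge 0:|X(t)|\ge r\}$, and let $\Phi(t)=\frac{(x,X(t))}{|x||X(t)|}$. Then for every $k=0,1,2,\ldots$ $$\frac{E^x C_k^{(\rho)}(\Phi(\tau_D))}{C_k^{(\rho)}(1)}=\left(\frac{|x|}{r}\right)^k\frac{F_k(|x|^2)}{F_k(r^2)} .$$
   Context: $(\cdot,\cdot)$ and $|\cdot|$ are the Euclidean inner product and norm. $\mathbb{D}^n=\{x\in\mathbb{R}^n:|x|<1\}$ is the ball model of real hyperbolic space with metric $ds^2=|dx|^2/(1-|x|^2)^2$. The hyperbolic Brownian motion is the diffusion on $\mathbb{D}^n$ with generator the Laplace–Beltrami operator $(1-|x|^2)^2\sum_i\frac{\partial^2}{\partial x_i^2}+2(n-2)(1-|x|^2)\sum_i x_i\frac{\partial}{\partial x_i}$; $E^x$ is expectation for the process started at $x$. For $x\neq0$ the process a.s. never hits $0$. $C_k^{(v)}$ ($v>0$) is the Gegenbauer polynomial, defined by $(1-2zh+h^2)^{-v}=\sum_{k\ge0}C_k^{(v)}(z)h^k$. $F_k(z)=F(k,-\rho;k+\frac n2;z)$, where $F(\alpha,\beta;\gamma;z)=\sum_{i\ge0}\frac{(\alpha)_i(\beta)_i}{(\gamma)_i\,i!}z^i$ is the Gauss hypergeometric function and $(\alpha)_i=\Gamma(\alpha+i)/\Gamma(\alpha)$.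 *)

theory Defs
  imports "HOL-Probability.Probability" "HOL-Complex_Analysis.Complex_Analysis"
begin

section \<open>Gegenbauer polynomials and the Gauss hypergeometric function\<close>

text \<open>The values \<open>C\<^sub>k\<^sup>v(z)\<close> are the coefficients of the expansion of
  \<open>(1 - 2zh + h\<^sup>2)\<^sup>-\<^sup>v\<close> in powers of \<open>h\<close> near \<open>h = 0\<close>; the base is positive there, so
  \<open>powr\<close> is the usual real power.\<close>

definition gegenbauer :: "real \<Rightarrow> nat \<Rightarrow> real \<Rightarrow> real" where
  "gegenbauer v k z =
     (THE c. \<forall>\<^sub>F h in nhds 0. (\<lambda>j. c j * h ^ j) sums ((1 - 2 * z * h + h\<^sup>2) powr (- v))) k"

lemma powser_coeffs_unique:
  fixes c d :: "nat \<Rightarrow> real"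
  assumes "\<forall>\<^sub>F h in nhds 0. (\<lambda>j. c j * h ^ j) sums g h"
      and "\<forall>\<^sub>F h in nhds 0. (\<lambda>j. d j * h ^ j) sums g h"
  shows "c = d"
proof -
  define a where "a = (\<lambda>j. c j - d j)"
  have ev: "\<forall>\<^sub>F h in nhds 0. (\<lambda>j. a j * h ^ j) sums 0"
    using assms
  proof eventually_elim
    case (elim h)
    then show ?case using sums_diff[OF elim] by (simp add: a_def algebra_simps)
  qed
  then obtain e where e: "e > 0" "\<And>h. \<bar>h\<bar> < e \<Longrightarrow> (\<lambda>j. a j * h ^ j) sums 0"
    unfolding eventually_nhds_metric by (auto simp: dist_real_def)
  have "a m = 0" for m
  proof (induction m rule: less_induct)
    case (less m)
    have "(\<lambda>j. a (j + m) * h ^ j) sums 0" if "h \<noteq> 0" "norm h < e" for h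
    proof -
      have "(\<lambda>j. a (j + m) * h ^ (j + m)) sums (0 - (\<Sum>j<m. a j * h ^ j))"
        using e(2)[of h] that by (subst sums_iff_shift') auto
      also have "(0 - (\<Sum>j<m. a j * h ^ j)) = 0" using less by simp
      finally have "(\<lambda>j. (a (j + m) * h ^ (j + m)) * inverse (h ^ m)) sums (0 * inverse (h ^ m))"
        by (rule sums_mult2)
      then show ?thesis using that by (simp add: power_add field_simps)
    qed
    then have "((\<lambda>_. 0) \<longlongrightarrow> a (0 + m)) (at (0::real))"
      using powser_limit_0_strong[OF e(1), of "\<lambda>j. a (j + m)" "\<lambda>_. 0"] by simp
    then show ?case
      using tendsto_unique[of "at (0::real)" "\<lambda>_. 0" "a m" 0] by simp
  qed
  then show ?thesis by (auto simp: a_def)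
qed

lemma gegenbauer_generating_function:
  "\<forall>\<^sub>F h in nhds 0. (\<lambda>k. gegenbauer v k z * h ^ k) sums ((1 - 2 * z * h + h\<^sup>2) powr (- v))"
proof -
  define f :: "complex \<Rightarrow> complex"
    where "f = (\<lambda>h. (1 - 2 * of_real z * h + h\<^sup>2) powr (- of_real v))"
  have "f analytic_on {0}"
    unfolding f_def by (intro analytic_intros) auto
  then have "f has_fps_expansion fps_expansion f 0"
    by (rule analytic_at_imp_has_fps_expansion_0)
  then have F: "fps_conv_radius (fps_expansion f 0) > 0"
    "\<forall>\<^sub>F h in nhds 0. eval_fps (fps_expansion f 0) h = f h"
    by (auto simp: has_fps_expansion_def)
  define F where "F = fps_expansion f 0"
  have "\<forall>\<^sub>F h in nhds 0. h \<in> eball 0 (fps_conv_radius F)"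
    using F(1) by (intro eventually_nhds_in_open) (auto simp: F_def zero_ereal_def)
  with F(2) have "\<forall>\<^sub>F h in nhds 0. (\<lambda>j. fps_nth F j * h ^ j) sums f h"
  proof eventually_elim
    case (elim h)
    then show ?case using sums_eval_fps[of h F] by (simp add: F_def)
  qed
  moreover have "filterlim (of_real :: real \<Rightarrow> complex) (nhds 0) (nhds 0)"
    using tendsto_of_real[OF filterlim_ident, of 0, where 'a = complex] by simp
  ultimately have ev: "\<forall>\<^sub>F h in nhds (0::real).
      (\<lambda>j. fps_nth F j * of_real h ^ j) sums f (of_real h)"
    by (rule eventually_compose_filterlim)
  have pos: "\<forall>\<^sub>F h in nhds (0::real). 1 - 2 * z * h + h\<^sup>2 > 0"
  proof -
    have "((\<lambda>h. 1 - 2 * z * h + h\<^sup>2) \<longlongrightarrow> 1 - 2 * z * 0 + 0\<^sup>2) (nhds (0::real))"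
      by (intro tendsto_intros filterlim_ident)
    then show ?thesis by (rule order_tendstoD) simp
  qed
  have ex: "\<forall>\<^sub>F h in nhds 0.
      (\<lambda>j. Re (fps_nth F j) * h ^ j) sums ((1 - 2 * z * h + h\<^sup>2) powr (- v))"
    using ev pos
  proof eventually_elim
    case (elim h)
    have "f (of_real h) = of_real (1 - 2 * z * h + h\<^sup>2) powr of_real (- v)"
      by (simp add: f_def)
    also have "\<dots> = of_real ((1 - 2 * z * h + h\<^sup>2) powr (- v))"
      using elim(2) by (intro powr_of_real) auto
    finally have "Re (f (of_real h)) = (1 - 2 * z * h + h\<^sup>2) powr (- v)"
      by simp
    moreover have "Re (fps_nth F j * of_real h ^ j) = Re (fps_nth F j) * h ^ j" for j
      by (simp flip: of_real_power)
    ultimately show ?case using sums_Re[OF elim(1)] by simp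
  qed
  have "(THE c. \<forall>\<^sub>F h in nhds 0. (\<lambda>j. c j * h ^ j) sums ((1 - 2 * z * h + h\<^sup>2) powr (- v)))
      = (\<lambda>j. Re (fps_nth F j))"
    by (rule the_equality, rule ex) (rule powser_coeffs_unique[OF _ ex])
  then have "gegenbauer v k z = Re (fps_nth F k)" for k
    by (simp add: gegenbauer_def)
  with ex show ?thesis by simp
qed

text \<open>\<open>pochhammer a i\<close> extends \<open>\<Gamma>(a + i) / \<Gamma>(a)\<close> to the poles of \<open>\<Gamma>\<close>. The upper
  parameters \<open>0\<close> and \<open>- (n - 2) / 2\<close> with \<open>n\<close> even are such poles.\<close>

definition gauss_hypergeometric :: "real \<Rightarrow> real \<Rightarrow> real \<Rightarrow> real \<Rightarrow> real" where
  "gauss_hypergeometric a b c z =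
     (\<Sum>i. pochhammer a i * pochhammer b i / (pochhammer c i * fact i) * z ^ i)"


section \<open>Hyperbolic Brownian motion on the ball\<close>

definition partial_deriv :: "'n::finite \<Rightarrow> (real ^ 'n \<Rightarrow> real) \<Rightarrow> real ^ 'n \<Rightarrow> real" where
  "partial_deriv i f y = frechet_derivative f (at y) (axis i 1)"

definition C1_fun :: "(real ^ 'n \<Rightarrow> real) \<Rightarrow> bool" where
  "C1_fun f \<longleftrightarrow>
     (\<forall>y. f differentiable at y) \<and> (\<forall>i. continuous_on UNIV (partial_deriv i f))"

definition C2_fun :: "(real ^ 'n \<Rightarrow> real) \<Rightarrow> bool" where
  "C2_fun f \<longleftrightarrow> C1_fun f \<and> (\<forall>i. C1_fun (partial_deriv i f))"

text \<open>The Laplace--Beltrami operator of \<open>ds\<^sup>2 = |dx|\<^sup>2 / (1 - |x|\<^sup>2)\<^sup>2\<close>.\<close>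

definition hyperbolic_laplacian :: "(real ^ 'n \<Rightarrow> real) \<Rightarrow> real ^ 'n \<Rightarrow> real" where
  "hyperbolic_laplacian f y =
     (1 - (norm y)\<^sup>2)\<^sup>2 * (\<Sum>i\<in>UNIV. partial_deriv i (partial_deriv i f) y)
     + 2 * (real CARD('n) - 2) * (1 - (norm y)\<^sup>2) * (\<Sum>i\<in>UNIV. y $ i * partial_deriv i f y)"

text \<open>The sigma-algebra generated by \<open>X s\<close> for \<open>0 \<le> s \<le> t\<close>.\<close>

definition past :: "'a measure \<Rightarrow> (real \<Rightarrow> 'a \<Rightarrow> 'b::topological_space) \<Rightarrow> real \<Rightarrow> 'a measure" where
  "past M X t =
     sigma (space M) {X s -` A \<inter> space M | s A. 0 \<le> s \<and> s \<le> t \<and> A \<in> sets borel}"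

text \<open>Time is \<open>[0, \<infinity>)\<close>; the values at negative indices are irrelevant.\<close>

definition martingale_wrt_past ::
    "'a measure \<Rightarrow> (real \<Rightarrow> 'a \<Rightarrow> 'b::topological_space) \<Rightarrow> (real \<Rightarrow> 'a \<Rightarrow> real) \<Rightarrow> bool" where
  "martingale_wrt_past M X N \<longleftrightarrow>
     (\<forall>t\<ge>0. integrable M (N t) \<and> N t \<in> borel_measurable (past M X t)) \<and>
     (\<forall>s t. 0 \<le> s \<and> s \<le> t \<longrightarrow>
        (AE \<omega> in M. real_cond_exp M (past M X s) (N t) \<omega> = N s \<omega>))"

text \<open>The diffusion with generator \<open>L\<close> started at \<open>x\<close>, in the sense of the martingale problem:
  a continuous process in the open unit ball such that
  \<open>f(X\<^sub>t) - f(X\<^sub>0) - \<integral>\<^sub>0\<^sup>t L f(X\<^sub>s) ds\<close> is a martingale for every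
  \<open>C\<^sup>2\<close> function \<open>f\<close> with compact support in the ball (functions on the ball with compact
  support are identified with their extensions by \<open>0\<close> to the whole space). Hyperbolic Brownian
  motion does not explode, so it stays in the ball for all times.\<close>

definition hyperbolic_brownian_motion ::
    "'a measure \<Rightarrow> (real \<Rightarrow> 'a \<Rightarrow> real ^ 'n) \<Rightarrow> real ^ 'n \<Rightarrow> bool" where
  "hyperbolic_brownian_motion M X x \<longleftrightarrow>
     prob_space M \<and>
     (\<forall>t\<ge>0. X t \<in> borel_measurable M) \<and>
     (\<forall>\<omega>\<in>space M. continuous_on {0..} (\<lambda>t. X t \<omega>)) \<and>
     (\<forall>\<omega>\<in>space M. \<forall>t\<ge>0. X t \<omega> \<in> ball 0 1) \<and>
     (AE \<omega> in M. X 0 \<omega> = x) \<and>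
     (\<forall>f. C2_fun f \<and> closure {y. f y \<noteq> 0} \<subseteq> ball 0 1 \<longrightarrow>
        martingale_wrt_past M X (\<lambda>t \<omega>. f (X t \<omega>) - f (X 0 \<omega>)
          - (LINT s:{0..t}|lborel. hyperbolic_laplacian f (X s \<omega>))))"

text \<open>The first time at which \<open>X\<close> is outside the centred ball of radius \<open>r\<close>, with
  \<open>Inf {} = \<infinity>\<close>.\<close>

definition exit_time :: "real \<Rightarrow> (real \<Rightarrow> 'a \<Rightarrow> 'b::real_normed_vector) \<Rightarrow> 'a \<Rightarrow> ereal" where
  "exit_time r X \<omega> = Inf (ereal ` {t. 0 \<le> t \<and> r \<le> norm (X t \<omega>)})"

text \<open>The position at an extended time. At time \<open>\<infinity>\<close> it is set to \<open>X 0\<close>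
  (\<open>real_of_ereal \<infinity> = 0\<close>); the exit time above is almost surely finite for hyperbolic
  Brownian motion and \<open>r < 1\<close>, so this convention does not affect expectations.\<close>

definition position_at :: "(real \<Rightarrow> 'a \<Rightarrow> 'b) \<Rightarrow> ('a \<Rightarrow> ereal) \<Rightarrow> 'a \<Rightarrow> 'b" where
  "position_at X \<tau> \<omega> = X (real_of_ereal (\<tau> \<omega>)) \<omega>"

definition cos_angle :: "'b::real_inner \<Rightarrow> 'b \<Rightarrow> real" where
  "cos_angle x y = (x \<bullet> y) / (norm x * norm y)"

end

theory Submission
  imports Defs "HOL-Real_Asymp.Real_Asymp"
begin

text \<open>
  Put \<open>u(y) = |y|\<^sup>k C\<^sub>k(cos \<angle>(x, y)) F\<^sub>k(|y|\<^sup>2)\<close>. The first two factors form a homogeneous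
  harmonic polynomial \<open>P\<close> of degree \<open>k\<close>, so the Laplace--Beltrami operator maps
  \<open>P(y) g(|y|\<^sup>2)\<close> to \<open>P(y)\<close> times an ordinary differential expression in \<open>g\<close>
  (\<open>hyperbolic_laplacian_solid_radial\<close>). That expression is a multiple of the hypergeometric
  equation of \<open>F\<^sub>k\<close> (\<open>hyp_deriv_ode\<close>), hence the operator annihilates \<open>u\<close> and \<open>u(X)\<close>,
  stopped at the exit time \<open>\<tau>\<close>, is a bounded martingale. Therefore \<open>u(x) = E u(X(\<tau>))\<close>. Since
  \<open>|X(\<tau>)| = r\<close>, the right-hand side is \<open>r\<^sup>k F\<^sub>k(r\<^sup>2)\<close> times the expectation of
  \<open>C\<^sub>k(\<Phi>(\<tau>))\<close>, and the formula follows by division, because \<open>C\<^sub>k(1)\<close> and \<open>F\<^sub>k(r\<^sup>2)\<close> are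
  positive (\<open>gegenbauer_at_1_pos\<close>, \<open>radial_hypergeometric_pos\<close>).

  Harmonicity is read off from the generating function: \<open>P(y)\<close> is the coefficient of \<open>h\<^sup>k\<close> in
  \<open>(1 - 2 (e \<bullet> y) h + |y|\<^sup>2 h\<^sup>2)\<close> to the power \<open>-\<rho>\<close> with \<open>e = x / |x|\<close>. As a formal power series
  in \<open>h\<close> it can be differentiated in \<open>y\<close> without any question of convergence, and its
  derivatives are combinations of the same series for \<open>\<rho> + 1\<close> and \<open>\<rho> + 2\<close>.

  The martingale problem speaks about test functions with compact support in the ball. So \<open>F\<^sub>k\<close>
  is first multiplied by a cutoff equal to one on \<open>[0, r\<^sup>2]\<close> (\<open>C2_cutoff\<close>). Optional stopping
  (\<open>optional_stopping\<close>) at \<open>min T \<tau>\<close> turns the martingale problem into Dynkin's formula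
  (\<open>dynkin_formula\<close>), and dominated convergence removes \<open>T\<close> once \<open>\<tau>\<close> is known to be almost
  surely finite. The latter follows from Dynkin's formula for a cutoff of \<open>|y|\<^sup>2\<close>, whose image
  under the operator is bounded below by a positive constant inside the ball
  (\<open>exit_time_finite_AE\<close>).
\<close>

section \<open>Solid Gegenbauer polynomials\<close>

text \<open>With \<open>t = e \<bullet> y\<close> and \<open>s = |y|\<^sup>2\<close> for a unit vector \<open>e\<close>, one plus this series in \<open>h\<close> is
  the squared distance \<open>|e - h y|\<^sup>2\<close>.\<close>

definition solid_base :: "real \<Rightarrow> real \<Rightarrow> real fps" where
  "solid_base t s = fps_X * (fps_const (- 2 * t) + fps_const s * fps_X)"

definition solid_gen :: "real \<Rightarrow> real \<Rightarrow> real \<Rightarrow> real fps" where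
  "solid_gen v t s = fps_binomial (- v) oo solid_base t s"

text \<open>For \<open>j = 0\<close> and \<open>s > 0\<close> this is \<open>s\<close> to the power \<open>k / 2\<close> times the Gegenbauer value at \<open>t / \<surd>s\<close>. The
  additional factor \<open>h\<^sup>j\<close> makes the family closed under \<open>\<partial>/\<partial>t\<close> and \<open>\<partial>/\<partial>s\<close>: they raise
  \<open>v\<close> by one and \<open>j\<close> by one or two, while \<open>k\<close> stays, so no index can become negative.\<close>

definition solid :: "real \<Rightarrow> nat \<Rightarrow> nat \<Rightarrow> real \<Rightarrow> real \<Rightarrow> real" where
  "solid v j k t s = fps_nth (fps_X ^ j * solid_gen v t s) k"

lemma solid_base_0 [simp]: "fps_nth (solid_base t s) 0 = 0"
  by (simp add: solid_base_def)

lemma solid_gen_mult_base: "solid_gen v t s = solid_gen (v + 1) t s * (1 + solid_base t s)"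
proof -
  have "fps_binomial (- v) = fps_binomial (- (v + 1)) * (1 + fps_X :: real fps)"
    using fps_binomial_add_mult[of "- (v + 1)" 1] by (simp add: fps_binomial_1)
  then show ?thesis
    by (simp add: solid_gen_def fps_compose_mult_distrib fps_compose_add_distrib)
qed

text \<open>Multiplication of the power \<open>-(v + 1)\<close> of the base by the base itself. Harmonicity of the solid
  polynomials rests on this identity, because the terms of second order in their Laplacian sum up
  to a multiple of its right-hand side.\<close>

lemma solid_contract:
  "solid v j k t s = solid (v + 1) j k t s - 2 * t * solid (v + 1) (j + 1) k t s
     + s * solid (v + 1) (j + 2) k t s"
proof -
  have "fps_X ^ j * solid_gen v t s = fps_X ^ j * solid_gen (v + 1) t s
      + fps_const (- 2 * t) * (fps_X ^ (j + 1) * solid_gen (v + 1) t s)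
      + fps_const s * (fps_X ^ (j + 2) * solid_gen (v + 1) t s)"
    unfolding solid_gen_mult_base[of v] solid_base_def by (simp add: algebra_simps)
  from arg_cong[OF this, of "\<lambda>f. fps_nth f k"] show ?thesis
    unfolding solid_def fps_add_nth fps_mult_left_const_nth by (simp del: power_Suc)
qed

lemma fps_deriv_binomial:
  "fps_deriv (fps_binomial a) = fps_const a * fps_binomial (a - 1 :: real)"
  unfolding fps_eq_iff by (simp add: gbinomial_absorption' gbinomial_absorb_comp)

lemma fps_deriv_solid_gen:
  "fps_deriv (solid_gen v t s)
     = fps_const (2 * v) * (fps_const t - fps_const s * fps_X) * solid_gen (v + 1) t s"
proof -
  have "fps_deriv (solid_gen v t s)
      = fps_const (- v) * solid_gen (v + 1) t s * fps_deriv (solid_base t s)"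
    by (simp add: solid_gen_def fps_compose_deriv fps_compose_mult_distrib
        fps_deriv_binomial[of "- v"])
  also have "fps_deriv (solid_base t s) = fps_const (- 2) * (fps_const t - fps_const s * fps_X)"
    by (simp add: solid_base_def algebra_simps fps_const_mult[symmetric] numeral_fps_const
      del: fps_const_mult)
  finally have "fps_deriv (solid_gen v t s) = fps_const (- v) * fps_const (- 2)
      * (fps_const t - fps_const s * fps_X) * solid_gen (v + 1) t s"
    by (simp only: mult_ac)
  then show ?thesis by (simp add: mult.commute)
qed

text \<open>Comparison of coefficients in \<open>h \<partial>/\<partial>h\<close> of the generating function. The left-hand side is
  \<open>t \<partial>/\<partial>t + 2 s \<partial>/\<partial>s\<close> applied to the solid polynomial, so this is Euler's identity for a
  homogeneous function of degree \<open>k\<close> in \<open>y\<close>.\<close>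

lemma solid_euler:
  "2 * v * (t * solid (v + 1) 1 k t s - s * solid (v + 1) 2 k t s) = real k * solid v 0 k t s"
proof -
  have "fps_X * fps_deriv (solid_gen v t s) =
      fps_const (2 * v) * (fps_const t * (fps_X ^ 1 * solid_gen (v + 1) t s)
       - fps_const s * (fps_X ^ 2 * solid_gen (v + 1) t s))"
    unfolding fps_deriv_solid_gen
    by (simp add: algebra_simps power2_eq_square fps_const_mult[symmetric] del: fps_const_mult)
  from arg_cong[OF this, of "\<lambda>f. fps_nth f k"] show ?thesis
    unfolding solid_def fps_sub_nth fps_mult_left_const_nth
    by (cases k) (simp_all del: power_Suc add: algebra_simps)
qed

text \<open>The induction on \<open>i\<close> needs the prefactor \<open>P\<close>: splitting off one factor of the base moves its
  powers of the formal variable into \<open>P\<close> and leaves \<open>T\<close> and \<open>S\<close> outside as scalars.\<close>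

lemma has_derivative_base_power:
  assumes T: "(T has_derivative T') (at y)" and S: "(S has_derivative S') (at y)"
  shows "((\<lambda>y. fps_nth (P * solid_base (T y) (S y) ^ i) k) has_derivative
     (\<lambda>h. real i * fps_nth (P * solid_base (T y) (S y) ^ (i - 1) 
        * (fps_X * (fps_const (- 2 * T' h) + fps_const (S' h) * fps_X))) k)) (at y)"
proof (induction i arbitrary: P k)
  case 0
  then show ?case by simp
next
  case (Suc i)
  have e: "fps_nth (P * solid_base t s ^ Suc i) k =
    (- 2 * t) * fps_nth ((P * fps_X) * solid_base t s ^ i) k
     + s * fps_nth ((P * fps_X^2) * solid_base t s ^ i) k" for t s
  proof -
    have "P * solid_base t s ^ Suc i = fps_const (- 2 * t) * ((P * fps_X) * solid_base t s ^ i)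
      + fps_const s * ((P * fps_X^2) * solid_base t s ^ i)"
      by (simp add: solid_base_def algebra_simps power2_eq_square)
    then show ?thesis by (simp only: fps_add_nth fps_mult_left_const_nth)
  qed
  show ?case unfolding e
    apply (rule derivative_eq_intros Suc.IH T S refl)+
    apply (rule ext)
    subgoal for h
    proof -
      define w where "w = solid_base (T y) (S y)"
      have w_eq: "w = fps_X * (fps_const (- 2 * T y) + fps_const (S y) * fps_X)"
        by (simp add: w_def solid_base_def)
      define d where "d = fps_X * (fps_const (- 2 * T' h) + fps_const (S' h) * fps_X)"
      have wi: "fps_const (real i) * (w * w ^ (i - 1)) = fps_const (real i) * w ^ i"
        by (cases i) auto
      have "fps_const (real (Suc i)) * (P * w ^ (Suc i - 1) * d)
         = P * d * w ^ i + P * d * (fps_const (real i) * w ^ i)"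
        by (simp add: algebra_simps fps_const_add[symmetric] del: fps_const_add)
      also have "\<dots> = P * d * w ^ i + w * (P * d * (fps_const (real i) * w ^ (i-1)))"
        unfolding wi[symmetric] by (simp add: algebra_simps)
      also have "\<dots> = fps_const (- 2 * T y) * (fps_const (real i) * (P * fps_X * w ^ (i-1) * d))
         + fps_const (- 2 * T' h) * (P * fps_X * w ^ i)
         + (fps_const (S y) * (fps_const (real i) * (P * fps_X\<^sup>2 * w ^ (i-1) * d))
            + fps_const (S' h) * (P * fps_X^2 * w ^ i))"
      proof -
        have "P * (fps_X * (fps_const (- 2 * T' h) + fps_const (S' h) * fps_X)) * w ^ i
            + fps_X * (fps_const (- 2 * T y) + fps_const (S y) * fps_X)
              * (P * d * (fps_const (real i) * w ^ (i - 1))) = fps_const (- 2 * T y) * (fps_const (real i) * (P * fps_X * w ^ (i-1) * d))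
         + fps_const (- 2 * T' h) * (P * fps_X * w ^ i)
         + (fps_const (S y) * (fps_const (real i) * (P * fps_X\<^sup>2 * w ^ (i-1) * d))
            + fps_const (S' h) * (P * fps_X^2 * w ^ i))"
          by (simp add: algebra_simps power2_eq_square)
        then show ?thesis by (simp only: d_def[symmetric] w_eq[symmetric])
      qed
      finally have *: "fps_const (real (Suc i)) * (P * w ^ (Suc i - 1) * d) = \<dots>" .
      show ?thesis
        using arg_cong[OF *, of "\<lambda>f. fps_nth f k", symmetric] 
        unfolding w_def d_def fps_add_nth fps_mult_left_const_nth by (simp add: mult_ac)
    qed
    done
qed


text \<open>High powers of \<open>w\<close> do not reach the coefficient \<open>k\<close>, so composition can be truncated at any
  \<open>N \<ge> k\<close>. The freedom in \<open>N\<close> pays for the index shift under differentiation.\<close>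

lemma fps_nth_mult_compose:
  fixes w :: "real fps"
  assumes "fps_nth w 0 = 0" and "k \<le> N"
  shows "fps_nth (Q * (a oo w)) k = (\<Sum>i\<le>N. fps_nth a i * fps_nth (Q * w ^ i) k)"
proof -
  have "fps_nth (a oo w) m = (\<Sum>i\<le>N. fps_nth a i * fps_nth (w ^ i) m)" if "m \<le> k" for m
    unfolding fps_compose_nth
    by (rule sum.mono_neutral_left) (use assms that startsby_zero_power_prefix[of w] in auto)
  then have "fps_nth (Q * (a oo w)) k
     = (\<Sum>m = 0..k. \<Sum>i\<le>N. fps_nth Q m * (fps_nth a i * fps_nth (w ^ i) (k - m)))"
    by (simp add: fps_mult_nth sum_distrib_left)
  also have "\<dots> = (\<Sum>i\<le>N. fps_nth a i * fps_nth (Q * w ^ i) k)"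
    by (subst sum.swap) (simp add: fps_mult_nth sum_distrib_left mult_ac)
  finally show ?thesis .
qed

text \<open>Differentiating the truncated composition term by term yields the composition of the
  differentiated binomial series, times the derivative of the base.\<close>

lemma has_derivative_solid [derivative_intros]:
  assumes T: "(T has_derivative T') (at y)" and S: "(S has_derivative S') (at y)"
  shows "((\<lambda>y. solid v j k (T y) (S y)) has_derivative
     (\<lambda>h. 2 * v * solid (v + 1) (j + 1) k (T y) (S y) * T' h
           - v * solid (v + 1) (j + 2) k (T y) (S y) * S' h)) (at y)"
proof -
  define a :: "real fps" where "a = fps_binomial (- v)"
  have s: "solid v j k t s = (\<Sum>i\<le>Suc k. fps_nth a i * fps_nth (fps_X ^ j * solid_base t s ^ i) k)"
    for t s
    unfolding solid_def solid_gen_def a_def by (rule fps_nth_mult_compose) auto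
  have "((\<lambda>y. \<Sum>i\<le>Suc k. fps_nth a i * fps_nth (fps_X ^ j * solid_base (T y) (S y) ^ i) k)
      has_derivative (\<lambda>h. \<Sum>i\<le>Suc k. fps_nth a i * (real i * fps_nth (fps_X ^ j *
           solid_base (T y) (S y) ^ (i - 1) *
           (fps_X * (fps_const (- 2 * T' h) + fps_const (S' h) * fps_X))) k))) (at y)"
    by (intro has_derivative_sum has_derivative_mult_right has_derivative_base_power T S)
  moreover have "(\<Sum>i\<le>Suc k. fps_nth a i * (real i * fps_nth (fps_X ^ j *
           solid_base (T y) (S y) ^ (i - 1) *
           (fps_X * (fps_const (- 2 * T' h) + fps_const (S' h) * fps_X))) k)) =
       2 * v * solid (v + 1) (j + 1) k (T y) (S y) * T' h
           - v * solid (v + 1) (j + 2) k (T y) (S y) * S' h" for h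
  proof -
    define w where "w = solid_base (T y) (S y)"
    define d where "d = fps_X * (fps_const (- 2 * T' h) + fps_const (S' h) * fps_X)"
    have "(\<Sum>i\<le>Suc k. fps_nth a i * (real i * fps_nth (fps_X ^ j * w ^ (i - 1) * d) k))
      = (\<Sum>i\<le>k. fps_nth (fps_deriv a) i * fps_nth ((fps_X ^ j * d) * w ^ i) k)"
      by (subst sum.atMost_Suc_shift) (simp add: mult_ac)
    also have "\<dots> = fps_nth ((fps_X ^ j * d) * (fps_deriv a oo w)) k"
      by (rule fps_nth_mult_compose[symmetric]) (auto simp: w_def)
    also have "fps_deriv a oo w = fps_const (- v) * solid_gen (v + 1) (T y) (S y)"
      by (simp add: a_def fps_deriv_binomial[of "- v"] fps_compose_mult_distrib w_def solid_gen_def)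
    also have "(fps_X ^ j * d) * (fps_const (- v) * solid_gen (v + 1) (T y) (S y)) =
        fps_const (2 * v * T' h) * (fps_X ^ (j + 1) * solid_gen (v + 1) (T y) (S y))
      - fps_const (v * S' h) * (fps_X ^ (j + 2) * solid_gen (v + 1) (T y) (S y))"
      by (simp add: d_def algebra_simps fps_const_mult[symmetric] fps_const_neg[symmetric]
         power2_eq_square numeral_fps_const del: fps_const_mult fps_const_neg)
    finally show ?thesis
      unfolding fps_sub_nth fps_mult_left_const_nth solid_def[symmetric]
      by (simp add: w_def d_def mult_ac)
  qed
  ultimately show ?thesis unfolding s[symmetric] by simp
qed

text \<open>Substitution of \<open>l h\<close> for \<open>h\<close> in the generating function.\<close>

lemma solid_scale: "solid v 0 k (l * t) (l\<^sup>2 * s) = l ^ k * solid v 0 k t s"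
proof -
  define L where "L = fps_const l * fps_X"
  have L0: "fps_nth L 0 = 0" by (simp add: L_def)
  have "solid_base (l * t) (l\<^sup>2 * s) = solid_base t s oo L"
  proof -
    have "solid_base t s oo L = L * (fps_const (- 2 * t) + fps_const s * L)"
      unfolding solid_base_def
      by (simp add: fps_compose_mult_distrib[OF L0] fps_compose_add_distrib
         fps_X_fps_compose_startby0[OF L0])
    then show ?thesis
      unfolding solid_base_def by (simp add: L_def algebra_simps
       fps_const_mult[symmetric] fps_const_neg[symmetric] power2_eq_square
       del: fps_const_mult fps_const_neg)
  qed
  then have "solid_gen v (l * t) (l\<^sup>2 * s) = solid_gen v t s oo L"
    unfolding solid_gen_def by (simp add: fps_compose_assoc L0)
  then show ?thesis
    by (simp add: solid_def L_def fps_compose_linear)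
qed

text \<open>The Gegenbauer values are coefficients of a convergent expansion, the solid polynomials come from
  a formal composition. Both series solve \<open>A C' = K C\<close>, where \<open>A\<close> is the base
  \<open>1 - 2 z h + h\<^sup>2\<close> and \<open>K = 2 v (z - h)\<close>. The series \<open>B\<close> with exponent \<open>+v\<close> is the inverse
  of the formal one and solves \<open>A B' = - K B\<close>, so the product \<open>C B\<close> has derivative zero.\<close>

lemma gegenbauer_eq_solid: "gegenbauer v k z = solid v 0 k z 1"
proof -
  define c where "c = (\<lambda>k. gegenbauer v k z)"
  define C where "C = Abs_fps c"
  define A :: "real fps" where "A = 1 + solid_base z 1"
  define K where "K = fps_const (2 * v) * (fps_const z - fps_X)"
  define g where "g = (\<lambda>h. (1 - 2 * z * h + h\<^sup>2) powr (- v))"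
  have gf: "\<forall>\<^sub>F h in nhds 0. (\<lambda>k. c k * h ^ k) sums g h"
    unfolding c_def g_def by (rule gegenbauer_generating_function)
  then obtain e where e: "e > 0" "\<And>h. \<bar>h\<bar> < e \<Longrightarrow> (\<lambda>j. c j * h ^ j) sums g h"
    unfolding eventually_nhds_metric by (auto simp: dist_real_def)
  have "summable (\<lambda>j. c j * (e/2) ^ j)"
    using e by (intro sums_summable[OF e(2)]) auto
  then have "conv_radius c \<ge> norm (e/2)" by (rule conv_radius_geI)
  then have rad: "fps_conv_radius C > 0"
    using e(1) unfolding C_def fps_conv_radius_def
    by (simp add: order_less_le_trans[OF _ \<open>conv_radius c \<ge> norm (e/2)\<close>])
  have gC: "g has_fps_expansion C"
    unfolding has_fps_expansion_def
    using rad gf by (auto simp: C_def eval_fps_def sums_iff elim!: eventually_mono)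
  have pos: "\<forall>\<^sub>F h in nhds (0::real). 1 - 2 * z * h + h\<^sup>2 > 0"
  proof -
    have "((\<lambda>h. 1 - 2 * z * h + h\<^sup>2) \<longlongrightarrow> 1 - 2 * z * 0 + 0\<^sup>2) (nhds (0::real))"
      by (intro tendsto_intros filterlim_ident)
    then show ?thesis by (rule order_tendstoD) simp
  qed
  have "(\<lambda>h. (1 + h * (- 2 * z + 1 * h)) * deriv g h - 2 * v * (z - h) * g h)
     has_fps_expansion A * fps_deriv C - K * C"
    unfolding A_def K_def solid_base_def
    by (intro fps_expansion_intros gC)
  then have x: "(\<lambda>h. (1 + h * (- 2 * z + 1 * h)) * deriv g h - 2 * v * (z - h) * g h)
     has_fps_expansion (A * fps_deriv C - K * C)" .
  have z: "\<forall>\<^sub>F h in nhds 0. (1 + h * (- 2 * z + 1 * h)) * deriv g h - 2 * v * (z - h) * g h = 0"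
    using pos
  proof eventually_elim
    case (elim h)
    have "(g has_real_derivative (- v) * (1 - 2 * z * h + h\<^sup>2) powr (- v - 1) * (2 * h - 2 * z)) (at h)"
      unfolding g_def using elim 
      by (auto intro!: derivative_eq_intros simp: algebra_simps powr_diff)
    then have "deriv g h = (- v) * (1 - 2 * z * h + h\<^sup>2) powr (- v - 1) * (2 * h - 2 * z)"
      by (rule DERIV_imp_deriv)
    moreover have "g h = (1 - 2 * z * h + h\<^sup>2) * (1 - 2 * z * h + h\<^sup>2) powr (- v - 1)"
      using elim powr_mult_base[of "1 - 2 * z * h + h\<^sup>2" "- v - 1"] by (simp add: g_def)
    ultimately show ?case
      by algebra
  qed
  have ode: "A * fps_deriv C = K * C"
  proof -
    define D where "D = A * fps_deriv C - K * C"
    have D: "fps_conv_radius D > 0" "\<forall>\<^sub>F h in nhds 0. eval_fps D h =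
         (1 + h * (- 2 * z + 1 * h)) * deriv g h - 2 * v * (z - h) * g h"
      using x unfolding D_def[symmetric] has_fps_expansion_def by auto
    have "\<forall>\<^sub>F h in nhds 0. h \<in> eball 0 (fps_conv_radius D)"
      using D(1) by (intro eventually_nhds_in_open) (auto simp: zero_ereal_def)
    with D(2) z have "\<forall>\<^sub>F h in nhds 0. (\<lambda>j. fps_nth D j * h ^ j) sums 0"
    proof eventually_elim
      case (elim h)
      then show ?case using sums_eval_fps[of h D] by simp
    qed
    then have "fps_nth D = (\<lambda>_. 0)"
      by (rule powser_coeffs_unique) simp
    then have "D = 0" by (simp add: fps_eq_iff)
    then show ?thesis by (simp add: D_def)
  qed
  define B where "B = solid_gen (- v) z 1"
  have B': "A * fps_deriv B = - K * B"
  proof -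
    define G where "G = solid_gen (- v + 1) z 1"
    have "fps_deriv B = - fps_const (2 * v) * (fps_const z - fps_X) * G"
      using fps_deriv_solid_gen[of "- v" z 1] by (simp add: B_def G_def)
    moreover have "B = G * A"
      unfolding B_def A_def G_def by (rule solid_gen_mult_base)
    ultimately show ?thesis by (simp add: K_def mult_ac del: fps_const_neg)
  qed
  have HB: "solid_gen v z 1 * B = 1"
    unfolding B_def solid_gen_def
    by (simp add: fps_compose_mult_distrib[symmetric] fps_binomial_add_mult[symmetric])
  have "A * fps_deriv (C * B) = 0"
  proof -
    have "A * fps_deriv (C * B) = (A * fps_deriv C) * B + C * (A * fps_deriv B)"
      by (simp add: algebra_simps)
    then show ?thesis unfolding ode B' by (simp add: algebra_simps)
  qed
  moreover have "A \<noteq> 0" 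
  proof -
    have "fps_nth A 0 = 1" by (simp add: A_def)
    then show ?thesis by auto
  qed
  ultimately have "fps_deriv (C * B) = 0" by simp
  then have "C * B = fps_const (fps_nth (C * B) 0)" by (rule fps_deriv_eq_0_iff[THEN iffD1])
  moreover have "fps_nth (C * B) 0 = 1"
  proof -
    have "fps_nth C 0 = 1"
      using has_fps_expansion_imp_0_eq_fps_nth_0[OF gC] by (simp add: g_def)
    then show ?thesis by (simp add: B_def solid_gen_def)
  qed
  ultimately have "C * B = 1" by simp
  then have "C = solid_gen v z 1"
    using HB by (metis mult.assoc mult.commute mult.right_neutral)
  then show ?thesis
    unfolding solid_def by (simp add: C_def c_def flip: \<open>C = solid_gen v z 1\<close>)
qed

text \<open>At \<open>z = 1\<close> the base is \<open>(1 - h)\<^sup>2\<close>, so the generating function is a negative power of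
  \<open>1 - h\<close>, whose coefficients are given by the binomial series.\<close>

lemma gegenbauer_at_1_pos:
  assumes "v > 0"
  shows "gegenbauer v k 1 > 0"
proof -
  define d where "d = (\<lambda>j. pochhammer (2 * v) j / fact j)"
  have "\<forall>\<^sub>F h in nhds 0. (\<lambda>j. d j * h ^ j) sums ((1 - 2 * 1 * h + h\<^sup>2) powr (- v))"
  proof -
    have "\<forall>\<^sub>F h in nhds (0::real). h \<in> ball 0 1"
      by (intro eventually_nhds_in_open) auto
    then show ?thesis
    proof eventually_elim
      case (elim h)
      have "(\<lambda>n. (- (2 * v) gchoose n) * (- h) ^ n) sums (1 + - h) powr (- (2 * v))"
        using elim by (intro gen_binomial_real) simp
      also have "(\<lambda>n. (- (2 * v) gchoose n) * (- h) ^ n) = (\<lambda>j. d j * h ^ j)"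
        by (auto simp: d_def gbinomial_pochhammer power_minus[of h] field_simps)
      also have "(1 + - h) powr (- (2 * v)) = ((1 - h) powr 2) powr (- v)"
        by (simp add: powr_powr)
      also have "(1 - h) powr 2 = 1 - 2 * 1 * h + h\<^sup>2"
        using elim by (simp add: powr_numeral power2_eq_square algebra_simps)
      finally show ?case .
    qed
  qed
  then have "gegenbauer v k 1 = d k"
    using powser_coeffs_unique[OF gegenbauer_generating_function[of v 1], of d] by metis
  then show ?thesis using assms by (simp add: d_def pochhammer_pos)
qed

lemma solid_0 [simp]: "solid v 0 0 t s = 1"
  by (simp add: solid_def solid_gen_def)

section \<open>The hypergeometric equation and positivity\<close>

definition hyp_coeff :: "real \<Rightarrow> real \<Rightarrow> real \<Rightarrow> nat \<Rightarrow> real" where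
  "hyp_coeff a b c i = pochhammer a i * pochhammer b i / (pochhammer c i * fact i)"

lemma gauss_hypergeometric_eq: "gauss_hypergeometric a b c z = (\<Sum>i. hyp_coeff a b c i * z ^ i)"
  by (simp add: gauss_hypergeometric_def hyp_coeff_def)

lemma hyp_coeff_Suc:
  "hyp_coeff a b c (Suc i)
    = (a + real i) * (b + real i) / ((c + real i) * (real i + 1)) * hyp_coeff a b c i"
  by (simp add: hyp_coeff_def pochhammer_Suc mult_ac add_ac)

lemma hyp_coeff_rec:
  assumes "c > 0"
  shows "(real i + 1) * (c + real i) * hyp_coeff a b c (Suc i)
    = (a + real i) * (b + real i) * hyp_coeff a b c i"
proof -
  have "c + real i \<noteq> 0" "real i + 1 \<noteq> 0" using assms by auto
  then show ?thesis by (simp add: hyp_coeff_Suc)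
qed

text \<open>The quotients of successive coefficients tend to one.\<close>

lemma summable_hyp_coeff:
  assumes "c > 0" and "\<bar>z\<bar> < 1"
  shows "summable (\<lambda>i. hyp_coeff a b c i * z ^ i)"
proof -
  define R where "R i = \<bar>(a + real i) * (b + real i) / ((c + real i) * (real i + 1))\<bar> * \<bar>z\<bar>" for i
  have "(\<lambda>i. (a + real i) * (b + real i) / ((c + real i) * (real i + 1))) \<longlonglongrightarrow> 1"
    by real_asymp
  then have "R \<longlonglongrightarrow> \<bar>1\<bar> * \<bar>z\<bar>"
    unfolding R_def by (intro tendsto_intros)
  then have "\<forall>\<^sub>F i in sequentially. R i < (1 + \<bar>z\<bar>) / 2"
    by (rule order_tendstoD) (use assms in auto)
  then obtain N where N: "\<And>i. i \<ge> N \<Longrightarrow> R i < (1 + \<bar>z\<bar>) / 2"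
    by (auto simp: eventually_sequentially)
  show ?thesis
  proof (rule summable_ratio_test[of "(1 + \<bar>z\<bar>) / 2" N])
    show "(1 + \<bar>z\<bar>) / 2 < 1" using assms by simp
    fix i assume i: "i \<ge> N"
    have "norm (hyp_coeff a b c (Suc i) * z ^ Suc i) = R i * norm (hyp_coeff a b c i * z ^ i)"
      by (simp add: hyp_coeff_Suc R_def abs_mult power_abs)
    also have "\<dots> \<le> (1 + \<bar>z\<bar>) / 2 * norm (hyp_coeff a b c i * z ^ i)"
      by (rule mult_right_mono[OF less_imp_le[OF N[OF i]]]) simp
    finally show "norm (hyp_coeff a b c (Suc i) * z ^ Suc i) \<le> \<dots>" .
  qed
qed

lemma sums_diffs_mult:
  fixes z :: real
  assumes "(\<lambda>i. diffs d i * z ^ i) sums D"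
  shows "(\<lambda>i. real i * d i * z ^ i) sums (z * D)"
proof -
  have "(\<lambda>i. real (Suc i) * d (Suc i) * z ^ Suc i) sums (z * D)"
    using sums_mult[OF assms, of z] by (simp add: diffs_def mult_ac)
  from sums_Suc[OF this] show ?thesis by simp
qed

definition hyp_deriv :: "nat \<Rightarrow> real \<Rightarrow> real \<Rightarrow> real \<Rightarrow> real \<Rightarrow> real" where
  "hyp_deriv m a b c z = (\<Sum>i. (diffs ^^ m) (hyp_coeff a b c) i * z ^ i)"

lemma gauss_hypergeometric_eq_hyp_deriv: "gauss_hypergeometric a b c = hyp_deriv 0 a b c"
  by (rule ext) (simp add: gauss_hypergeometric_eq hyp_deriv_def)

lemma summable_hyp_deriv:
  assumes "c > 0" and "\<bar>z\<bar> < 1"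
  shows "summable (\<lambda>i. (diffs ^^ m) (hyp_coeff a b c) i * z ^ i)"
  using assms(2)
proof (induction m arbitrary: z)
  case 0
  then show ?case using summable_hyp_coeff[OF assms(1)] by simp
next
  case (Suc m)
  then show ?case by (simp, intro termdiff_converges[where K = 1]) auto
qed

lemma DERIV_hyp_deriv:
  assumes "c > 0" and "\<bar>z\<bar> < 1"
  shows "(hyp_deriv m a b c has_real_derivative hyp_deriv (Suc m) a b c z) (at z)"
proof -
  define K where "K = (1 + \<bar>z\<bar>) / 2"
  have "norm z < norm K" "\<bar>K\<bar> < 1" using assms by (auto simp: K_def)
  then show ?thesis
    using termdiffs_strong[OF summable_hyp_deriv[OF assms(1)], of K z m a b]
    by (simp add: hyp_deriv_def[abs_def])
qed

text \<open>The coefficient of \<open>z\<^sup>i\<close> in the hypergeometric equation vanishes by \<open>hyp_coeff_rec\<close>.\<close>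

lemma hyp_deriv_ode:
  assumes c: "c > 0" and z: "\<bar>z\<bar> < 1"
  shows "z * (1 - z) * hyp_deriv 2 a b c z + (c - (a + b + 1) * z) * hyp_deriv 1 a b c z
    - a * b * hyp_deriv 0 a b c z = 0"
proof -
  let ?h = "hyp_coeff a b c"
  have s: "(\<lambda>i. (diffs ^^ m) ?h i * z ^ i) sums hyp_deriv m a b c z" for m
    unfolding hyp_deriv_def by (intro summable_sums summable_hyp_deriv assms)
  have s0: "(\<lambda>i. ?h i * z ^ i) sums hyp_deriv 0 a b c z" using s[of 0] by simp
  have s1: "(\<lambda>i. diffs ?h i * z ^ i) sums hyp_deriv 1 a b c z" using s[of 1] by simp
  have s2: "(\<lambda>i. diffs (diffs ?h) i * z ^ i) sums hyp_deriv 2 a b c z"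
    using s[of 2] by (simp add: numeral_2_eq_2)
  have z1: "(\<lambda>i. real i * ?h i * z ^ i) sums (z * hyp_deriv 1 a b c z)"
    by (rule sums_diffs_mult[OF s1])
  have z2: "(\<lambda>i. real i * diffs ?h i * z ^ i) sums (z * hyp_deriv 2 a b c z)"
    by (rule sums_diffs_mult[OF s2])
  have "(\<lambda>i. (real (Suc i) - 1) * real (Suc i) * ?h (Suc i) * z ^ Suc i)
     sums (z * (z * hyp_deriv 2 a b c z))"
    using sums_mult[OF z2, of z] by (simp add: diffs_def mult_ac)
  from sums_Suc[OF this]
  have zz2: "(\<lambda>i. (real i - 1) * real i * ?h i * z ^ i) sums (z * (z * hyp_deriv 2 a b c z))"
    by simp
  have "(\<lambda>i. real i * diffs ?h i * z ^ i - (real i - 1) * real i * ?h i * z ^ i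
      + (c * (diffs ?h i * z ^ i) - (a + b + 1) * (real i * ?h i * z ^ i)) - a * b * (?h i * z ^ i))
    sums (z * hyp_deriv 2 a b c z - z * (z * hyp_deriv 2 a b c z)
      + (c * hyp_deriv 1 a b c z - (a + b + 1) * (z * hyp_deriv 1 a b c z))
      - a * b * hyp_deriv 0 a b c z)"
    by (intro sums_add sums_diff sums_mult s0 s1 z1 z2 zz2)
  also have "(\<lambda>i. real i * diffs ?h i * z ^ i - (real i - 1) * real i * ?h i * z ^ i
      + (c * (diffs ?h i * z ^ i) - (a + b + 1) * (real i * ?h i * z ^ i)) - a * b * (?h i * z ^ i))
     = (\<lambda>i. ((real i + 1) * (c + real i) * ?h (Suc i)
         - (a + real i) * (b + real i) * ?h i) * z ^ i)"
    by (auto simp: diffs_def algebra_simps)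
  also have "\<dots> = (\<lambda>i. 0)" by (simp only: hyp_coeff_rec[OF c]) simp
  finally have "(\<lambda>i. 0::real) sums (z * hyp_deriv 2 a b c z - z * (z * hyp_deriv 2 a b c z)
      + (c * hyp_deriv 1 a b c z - (a + b + 1) * (z * hyp_deriv 1 a b c z))
      - a * b * hyp_deriv 0 a b c z)" .
  then have "z * hyp_deriv 2 a b c z - z * (z * hyp_deriv 2 a b c z)
      + (c * hyp_deriv 1 a b c z - (a + b + 1) * (z * hyp_deriv 1 a b c z))
      - a * b * hyp_deriv 0 a b c z = 0"
    using sums_unique2 sums_zero by blast
  then show ?thesis by (simp add: algebra_simps)
qed

lemma hyp_deriv_0_at_0: "hyp_deriv 0 a b c 0 = 1"
proof -
  have "hyp_deriv 0 a b c 0 = hyp_coeff a b c 0"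
    unfolding hyp_deriv_def by (simp add: powser_zero)
  then show ?thesis by (simp add: hyp_coeff_def)
qed

text \<open>The set where \<open>g \<le> 0\<close> is compact, hence has a least element, and the intermediate value theorem
  shows that \<open>g\<close> vanishes there.\<close>

lemma first_zero:
  fixes g :: "real \<Rightarrow> real"
  assumes cont: "continuous_on {0..b} g" and "g 0 > 0" and "0 \<le> b" and "g b \<le> 0"
  obtains s where "0 < s" "s \<le> b" "g s = 0" "\<And>t. 0 \<le> t \<Longrightarrow> t < s \<Longrightarrow> g t > 0"
proof -
  define Z where "Z = {0..b} \<inter> g -` {..0}"
  have "closed Z" unfolding Z_def
    by (rule continuous_closed_preimage[OF cont]) auto
  then have "compact Z"
    using compact_Int_closed[OF compact_Icc[of 0 b], of Z] by (simp add: Z_def Int_absorb1)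
  moreover have "Z \<noteq> {}" using assms by (auto simp: Z_def)
  ultimately obtain s where s: "s \<in> Z" "\<And>t. t \<in> Z \<Longrightarrow> s \<le> t"
    by (metis compact_attains_inf)
  have pos: "g t > 0" if "0 \<le> t" "t < s" for t
    using that s by (force simp: Z_def not_less)
  have "continuous_on {0..s} g"
    by (rule continuous_on_subset[OF cont]) (use s in \<open>auto simp: Z_def\<close>)
  then have "\<exists>t\<ge>0. t \<le> s \<and> g t = 0"
    by (intro IVT2') (use assms s in \<open>auto simp: Z_def\<close>)
  then have "g s = 0" using pos by (metis order_less_irrefl order_le_less)
  moreover have "s \<noteq> 0" using \<open>g s = 0\<close> assms by auto
  ultimately show ?thesis using s pos by (intro that[of s]) (auto simp: Z_def)
qed

text \<open>The second parameter is negative, so positivity is not visible from the coefficients. It holds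
  because the radial profile \<open>t\<^sup>k F(t\<^sup>2)\<close> increases. Up to a power of \<open>t\<close>, its derivative is
  \<open>W(t\<^sup>2)\<close> with \<open>W(z) = k F(z) + 2 z F'(z)\<close>, and the hypergeometric equation becomes a first-order
  linear equation for \<open>W\<close> whose inhomogeneity is a positive multiple of \<open>F\<close>. At a first zero of \<open>W\<close>
  where \<open>F > 0\<close>, that equation would give \<open>W' > 0\<close>, which is absurd; so \<open>W > 0\<close> as long as \<open>F > 0\<close>.
  Then \<open>z\<^sup>k F(z)\<^sup>2\<close> increases up to a first zero of \<open>F\<close>, and there is none.\<close>

lemma radial_hypergeometric_pos:
  fixes k :: nat and N :: real
  assumes N: "N > 2" and s: "0 \<le> s" "s < 1"
  shows "gauss_hypergeometric (real k) (- ((N - 2) / 2)) (real k + N / 2) s > 0"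
proof (cases "k = 0")
  case True
  have "(\<Sum>i. hyp_coeff 0 b c i * s ^ i) = 1" for b c
    by (subst suminf_finite[of "{0}"]) (auto simp: hyp_coeff_def pochhammer_0_left)
  then show ?thesis by (simp add: True gauss_hypergeometric_eq)
next
  case False
  define a b c where "a = real k" and "b = - ((N - 2) / 2)" and "c = real k + N / 2"
  have c: "c > 0" using N by (simp add: c_def)
  define F where "F m = hyp_deriv m a b c" for m
  have dF: "(F m has_real_derivative F (Suc m) t) (at t)" if "0 \<le> t" "t < 1" for m t
    unfolding F_def using that by (intro DERIV_hyp_deriv c) auto
  define W where "W t = k * F 0 t + 2 * t * F 1 t" for t
  have dW: "(W has_real_derivative k * F 1 t + 2 * F 1 t + 2 * t * F 2 t) (at t)"
    if "0 \<le> t" "t < 1" for t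
    unfolding W_def using that
    by (auto intro!: derivative_eq_intros dF simp: numeral_2_eq_2)
  define m where "m = (N - 2) / 2"
  have N_m: "N = 2 * m + 2" and b_m: "b = - m" and c_m: "c = k + m + 1"
    by (auto simp: m_def b_def c_def field_simps)
  \<comment> \<open>The hypergeometric equation multiplied by \<open>4 t\<close>, with \<open>F''\<close> expressed through \<open>W'\<close>.\<close>
  have W_ode: "t * (1 - t) * (k * F 1 t + 2 * F 1 t + 2 * t * F 2 t) * 2
      = (2 * m + k) * k * (1 - t) * F 0 t - ((2 * m + k) * (1 - t) + 4 * m * t) * W t"
    if "0 \<le> t" "t < 1" for t
  proof -
    have "t * (1 - t) * F 2 t + (c - (a + b + 1) * t) * F 1 t - a * b * F 0 t = 0"
      unfolding F_def using that by (intro hyp_deriv_ode c) auto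
    moreover have "t * (1 - t) * (k * F 1 t + 2 * F 1 t + 2 * t * F 2 t) * 2
      - ((2 * m + k) * k * (1 - t) * F 0 t - ((2 * m + k) * (1 - t) + 4 * m * t) * W t)
      = 4 * t * (t * (1 - t) * F 2 t + (c - (a + b + 1) * t) * F 1 t - a * b * F 0 t)"
      unfolding W_def a_def b_m c_m by algebra
    ultimately show ?thesis by simp
  qed
  have m: "m > 0" using N by (simp add: m_def)
  have F00: "F 0 0 = 1" by (simp add: F_def hyp_deriv_0_at_0)
  have "F 0 s > 0"
  proof (rule ccontr)
    assume neg: "\<not> F 0 s > 0"
    have "continuous_on {0..s} (F 0)"
      using s by (intro continuous_at_imp_continuous_on ballI DERIV_isCont[OF dF]) auto
    then obtain u where u: "0 < u" "u \<le> s" "F 0 u = 0" "\<And>t. 0 \<le> t \<Longrightarrow> t < u \<Longrightarrow> F 0 t > 0"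
      by (rule first_zero[of s "F 0"]) (use s neg F00 in auto)
    have Wpos: "W t > 0" if t: "0 \<le> t" "t < u" for t
    proof (rule ccontr)
      assume "\<not> W t > 0"
      moreover have "continuous_on {0..t} W"
        using t u s by (intro continuous_at_imp_continuous_on ballI DERIV_isCont[OF dW]) auto
      moreover have "W 0 > 0" using False by (simp add: W_def F_def hyp_deriv_0_at_0)
      ultimately obtain w where w: "0 < w" "w \<le> t" "W w = 0" "\<And>t. 0 \<le> t \<Longrightarrow> t < w \<Longrightarrow> W t > 0"
        using first_zero[of t W thesis] t by (auto simp: not_less)
      have w1: "w < 1" using w t u s by linarith
      define D where "D = k * F 1 w + 2 * F 1 w + 2 * w * F 2 w"
      have "w * (1 - w) * D * 2 = (2 * m + k) * k * (1 - w) * F 0 w"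
        using W_ode[of w] w w1 by (simp add: D_def)
      moreover have "(2 * m + k) * k * (1 - w) * F 0 w > 0"
        using m False w1 u(4)[of w] w t by (intro mult_pos_pos) auto
      ultimately have "w * (1 - w) * D * 2 > 0" by (simp only:)
      then have pos: "w * (1 - w) * (D * 2) > 0" by (simp only: mult.assoc)
      have "w * (1 - w) > 0" using w w1 by simp
      with pos have "D * 2 > 0" by (rule zero_less_mult_pos)
      then have "D > 0" by simp
      moreover have "(W has_real_derivative D) (at w)"
        unfolding D_def using w w1 by (intro dW) auto
      ultimately obtain d where d: "d > 0" "\<And>h. h > 0 \<Longrightarrow> h < d \<Longrightarrow> W (w - h) < W w"
        using DERIV_pos_inc_left by blast
      define h where "h = min d w / 2"
      have "h > 0" "h < d" "0 \<le> w - h" "w - h < w" using d w by (auto simp: h_def)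
      then show False using d(2)[of h] w(3) w(4)[of "w - h"] by auto
    qed
    define E where "E t = t ^ k * (F 0 t)\<^sup>2" for t
    \<comment> \<open>The starting point \<open>u / 2\<close> avoids \<open>0\<close>, where \<open>E\<close> vanishes for every \<open>F\<close>.\<close>
    have "E (u / 2) \<le> E u"
    proof (rule DERIV_nonneg_imp_nondecreasing[where f = E])
      show "u / 2 \<le> u" using u by simp
      fix t assume t: "u / 2 \<le> t" "t \<le> u"
      then have t0: "0 < t" "t < 1" using u s by auto
      have "(E has_real_derivative k * t ^ (k - 1) * (F 0 t)\<^sup>2 + t ^ k * (2 * F 0 t * F 1 t)) (at t)"
        unfolding E_def using t0 by (auto intro!: derivative_eq_intros dF)
      also have "k * t ^ (k - 1) * (F 0 t)\<^sup>2 + t ^ k * (2 * F 0 t * F 1 t) = t ^ (k - 1) * F 0 t * W t"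
        using False by (cases k) (auto simp: W_def power2_eq_square algebra_simps)
      finally have "(E has_real_derivative t ^ (k - 1) * F 0 t * W t) (at t)" .
      moreover have "t ^ (k - 1) * F 0 t * W t \<ge> 0"
        using t0 t u(3) u(4)[of t] Wpos[of t] by (cases "t = u") auto
      ultimately show "\<exists>y. (E has_real_derivative y) (at t) \<and> 0 \<le> y" by blast
    qed
    moreover have "E u = 0" using u by (simp add: E_def)
    moreover have "E (u / 2) > 0" unfolding E_def using u(1) u(4)[of "u / 2"] by (intro mult_pos_pos zero_less_power) auto
    ultimately show False by simp
  qed
  then show ?thesis by (simp add: F_def gauss_hypergeometric_eq_hyp_deriv a_def b_def c_def)
qed

section \<open>Twice continuously differentiable cutoffs\<close>

definition C2_real :: "(real \<Rightarrow> real) \<Rightarrow> (real \<Rightarrow> real) \<Rightarrow> (real \<Rightarrow> real) \<Rightarrow> bool" where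
  "C2_real g g1 g2 \<longleftrightarrow> (\<forall>s. (g has_real_derivative g1 s) (at s)) \<and>
     (\<forall>s. (g1 has_real_derivative g2 s) (at s)) \<and> continuous_on UNIV g2"

text \<open>In particular the cube of the positive part is twice continuously differentiable.\<close>

lemma DERIV_pos_part_power:
  "((\<lambda>x. max 0 x ^ (n + 2)) has_real_derivative real (n + 2) * max 0 x ^ (n + 1)) (at (x::real))"
proof -
  consider "x > 0" | "x < 0" | "x = 0" by linarith
  then show ?thesis
  proof cases
    case 1
    have "((\<lambda>x. x ^ (n + 2)) has_real_derivative real (n + 2) * x ^ (n + 1)) (at x)"
      by (rule derivative_eq_intros refl)+ simp
    then have "((\<lambda>x. max 0 x ^ (n + 2)) has_real_derivative real (n + 2) * x ^ (n + 1)) (at x)"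
      by (rule has_field_derivative_transform_within_open[of _ _ _ "{0<..}"]) (use 1 in auto)
    then show ?thesis using 1 by simp
  next
    case 2
    have "((\<lambda>x. 0) has_real_derivative 0) (at x)" by simp
    then have "((\<lambda>x. max 0 x ^ (n + 2)) has_real_derivative 0) (at x)"
      by (rule has_field_derivative_transform_within_open[of _ _ _ "{..<0}"]) (use 2 in auto)
    then show ?thesis using 2 by simp
  next
    case 3
    have "((\<lambda>h. max 0 h ^ (n + 2) / h) \<longlongrightarrow> 0) (at (0::real))"
    proof (rule tendsto_0_le[where K = 1])
      show "((\<lambda>h::real. h ^ (n + 1)) \<longlongrightarrow> 0) (at 0)"
        by (rule tendsto_eq_intros refl)+ simp
      show "\<forall>\<^sub>F h in at (0::real). norm (max 0 h ^ (n + 2) / h) \<le> norm (h ^ (n + 1)) * 1"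
        by (rule always_eventually) (auto simp: max_def power_abs)
    qed
    then show ?thesis using 3 by (simp add: DERIV_def)
  qed
qed

text \<open>Let \<open>c\<close> be the cube of the positive part and \<open>\<psi>(s) = 1 - c(1 - m c(b\<^sup>2 - s\<^sup>2))\<close>. For
  \<open>|s| \<ge> b\<close> the inner cube vanishes and \<open>\<psi> = 1 - c(1) = 0\<close>. The constant \<open>m\<close> is chosen such that
  \<open>m c(b\<^sup>2 - s\<^sup>2) \<ge> 1\<close> for \<open>|s| \<le> a\<close>, where the outer cube therefore vanishes.\<close>

lemma cutoff_exists:
  assumes "0 \<le> a" "a < b"
  obtains \<psi> \<psi>1 \<psi>2 where "C2_real \<psi> \<psi>1 \<psi>2"
    and "\<And>s. \<bar>s\<bar> \<le> a \<Longrightarrow> \<psi> s = 1 \<and> \<psi>1 s = 0 \<and> \<psi>2 s = 0"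
    and "\<And>s. \<bar>s\<bar> \<ge> b \<Longrightarrow> \<psi> s = 0 \<and> \<psi>1 s = 0 \<and> \<psi>2 s = 0"
proof -
  define c where "c j x = max 0 (x::real) ^ j" for j :: nat and x
  have dc: "(c 3 has_real_derivative 3 * c 2 x) (at x)" "(c 2 has_real_derivative 2 * c 1 x) (at x)" for x
    using DERIV_pos_part_power[of 1 x] DERIV_pos_part_power[of 0 x] 
    by (simp_all add: c_def[abs_def] eval_nat_numeral)
  have cc: "continuous_on A (c j)" for A j unfolding c_def by (intro continuous_intros)
  have c0: "c j x = 0" if "x \<le> 0" "j > 0" for j x using that by (simp add: c_def max_def)
  define m where "m = 1 / (b\<^sup>2 - a\<^sup>2) ^ 3"
  have ab: "a\<^sup>2 < b\<^sup>2" using assms by (simp add: power_strict_mono)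
  then have m: "m > 0" by (simp add: m_def)
  define w where "w s = b\<^sup>2 - s\<^sup>2" for s :: real
  define q where "q s = 1 - m * c 3 (w s)" for s
  define \<psi> where "\<psi> s = 1 - c 3 (q s)" for s
  define \<psi>1 where "\<psi>1 s = - (18 * m * s * c 2 (q s) * c 2 (w s))" for s
  define \<psi>2 where "\<psi>2 s = - (18 * m * (c 2 (q s) * c 2 (w s)
      + s * (2 * c 1 (q s) * (6 * m * s * c 2 (w s)) * c 2 (w s) - 4 * s * c 2 (q s) * c 1 (w s))))" for s
  have dw: "(w has_real_derivative (- 2 * s)) (at s)" for s
    unfolding w_def by (auto intro!: derivative_eq_intros)
  note dcw = DERIV_chain2[OF dc(1) dw] DERIV_chain2[OF dc(2) dw]
  have dq: "(q has_real_derivative 6 * m * s * c 2 (w s)) (at s)" for s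
    unfolding q_def by (rule derivative_eq_intros dcw refl)+ simp
  note dcq = DERIV_chain2[OF dc(1) dq] DERIV_chain2[OF dc(2) dq]
  have d1: "(\<psi> has_real_derivative \<psi>1 s) (at s)" for s
    unfolding \<psi>_def by (rule derivative_eq_intros dcq refl)+ (simp add: \<psi>1_def)
  have d2: "(\<psi>1 has_real_derivative \<psi>2 s) (at s)" for s
    unfolding \<psi>1_def
    by (rule derivative_eq_intros dcq dcw refl)+ (simp add: \<psi>2_def algebra_simps)
  have cw: "continuous_on A w" "continuous_on A q" for A
    unfolding w_def by (intro continuous_intros)
      (intro continuous_at_imp_continuous_on ballI DERIV_isCont[OF dq])
  have "continuous_on UNIV \<psi>2"
    unfolding \<psi>2_def
    by (intro continuous_intros continuous_on_compose2[OF cc[of UNIV]] cw) auto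
  then have "C2_real \<psi> \<psi>1 \<psi>2" using d1 d2 by (simp add: C2_real_def)
  moreover have "\<psi> s = 1 \<and> \<psi>1 s = 0 \<and> \<psi>2 s = 0" if "\<bar>s\<bar> \<le> a" for s
  proof -
    have "s\<^sup>2 \<le> a\<^sup>2" using power_mono[OF that, of 2] by simp
    then have "(b\<^sup>2 - a\<^sup>2) ^ 3 \<le> c 3 (w s)"
      unfolding c_def w_def using ab by (intro power_mono) auto
    then have "q s \<le> 0" using ab by (simp add: q_def m_def field_simps)
    then show ?thesis by (simp add: \<psi>_def \<psi>1_def \<psi>2_def c0)
  qed
  moreover have "\<psi> s = 0 \<and> \<psi>1 s = 0 \<and> \<psi>2 s = 0" if "\<bar>s\<bar> \<ge> b" for s
  proof -
    have "b\<^sup>2 \<le> s\<^sup>2" using power_mono[OF that, of 2] assms by simp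
    then have "w s \<le> 0" by (simp add: w_def)
    then show ?thesis by (simp add: \<psi>_def \<psi>1_def \<psi>2_def c0 q_def) (simp add: c_def)
  qed
  ultimately show ?thesis by (rule that)
qed

text \<open>The open sets \<open>|s| < 1\<close> and \<open>|s| > b\<close> cover the line, and on the second one the extended
  function is zero.\<close>

lemma DERIV_extend_by_zero:
  fixes g :: "real \<Rightarrow> real"
  assumes "b < 1" and d: "\<And>s. \<bar>s\<bar> < 1 \<Longrightarrow> (g has_real_derivative g' s) (at s)"
    and z: "\<And>s. \<bar>s\<bar> \<ge> b \<Longrightarrow> g s = 0 \<and> g' s = 0"
  shows "((\<lambda>s. if \<bar>s\<bar> < 1 then g s else 0) has_real_derivative (if \<bar>s\<bar> < 1 then g' s else 0)) (at s)"
proof (cases "\<bar>s\<bar> < 1")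
  case True
  then show ?thesis
    using has_field_derivative_transform_within_open[OF d[OF True], of "ball 0 1"] by auto
next
  case False
  have o: "open {s::real. b < \<bar>s\<bar>}" by (intro open_Collect_less continuous_intros)
  have "((\<lambda>_. 0) has_real_derivative 0) (at s)" by simp
  then have "((\<lambda>s. if \<bar>s\<bar> < 1 then g s else 0) has_real_derivative 0) (at s)"
    by (rule has_field_derivative_transform_within_open[OF _ o]) (use False \<open>b < 1\<close> z in auto)
  then show ?thesis using False by simp
qed

text \<open>This turns a radial factor known only for \<open>|s| < 1\<close>, such as a hypergeometric series, into the
  radial factor of an admissible test function.\<close>

lemma C2_cutoff:
  fixes F F1 F2 :: "real \<Rightarrow> real"
  assumes ab: "0 \<le> a" "a < b" "b < 1"
    and F: "\<And>s. \<bar>s\<bar> < 1 \<Longrightarrow> (F has_real_derivative F1 s) (at s)"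
    and F1: "\<And>s. \<bar>s\<bar> < 1 \<Longrightarrow> (F1 has_real_derivative F2 s) (at s)"
    and F2: "\<And>s. \<bar>s\<bar> < 1 \<Longrightarrow> isCont F2 s"
  obtains g g1 g2 where "C2_real g g1 g2"
    and "\<And>s. \<bar>s\<bar> \<le> a \<Longrightarrow> g s = F s \<and> g1 s = F1 s \<and> g2 s = F2 s"
    and "\<And>s. \<bar>s\<bar> \<ge> b \<Longrightarrow> g s = 0"
proof -
  obtain \<psi> \<psi>1 \<psi>2 where psi: "C2_real \<psi> \<psi>1 \<psi>2"
    and one: "\<And>s. \<bar>s\<bar> \<le> a \<Longrightarrow> \<psi> s = 1 \<and> \<psi>1 s = 0 \<and> \<psi>2 s = 0"
    and zero: "\<And>s. \<bar>s\<bar> \<ge> b \<Longrightarrow> \<psi> s = 0 \<and> \<psi>1 s = 0 \<and> \<psi>2 s = 0"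
    using cutoff_exists[OF ab(1,2)] by metis
  define E where "E h = (\<lambda>s::real. if \<bar>s\<bar> < 1 then h s else (0::real))" for h
  define h where "h s = \<psi> s * F s" for s
  define h1 where "h1 s = \<psi>1 s * F s + \<psi> s * F1 s" for s
  define h2 where "h2 s = \<psi>2 s * F s + 2 * \<psi>1 s * F1 s + \<psi> s * F2 s" for s
  have dpsi: "(\<psi> has_real_derivative \<psi>1 s) (at s)" "(\<psi>1 has_real_derivative \<psi>2 s) (at s)"
     "isCont \<psi>2 s" for s
    using psi by (auto simp: C2_real_def continuous_on_eq_continuous_at)
  have d: "(E h has_real_derivative E h1 s) (at s)" for s
    unfolding E_def
  proof (rule DERIV_extend_by_zero[OF ab(3)])
    show "(h has_real_derivative h1 s) (at s)" if "\<bar>s\<bar> < 1" for s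
      unfolding h_def by (rule derivative_eq_intros dpsi F that refl)+ (simp add: h1_def)
  qed (auto simp: h_def h1_def zero)
  have d1: "(E h1 has_real_derivative E h2 s) (at s)" for s
    unfolding E_def
  proof (rule DERIV_extend_by_zero[OF ab(3)])
    show "(h1 has_real_derivative h2 s) (at s)" if "\<bar>s\<bar> < 1" for s
      unfolding h1_def by (rule derivative_eq_intros dpsi F F1 that refl)+ (simp add: h2_def algebra_simps)
  qed (auto simp: h1_def h2_def zero)
  have c2: "isCont (E h2) s" for s
  proof (cases "\<bar>s\<bar> < 1")
    case True
    have "isCont h2 s"
      unfolding h2_def using True
      by (intro continuous_intros dpsi F2 DERIV_isCont[OF dpsi(1)] DERIV_isCont[OF dpsi(2)]
         DERIV_isCont[OF F] DERIV_isCont[OF F1])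
    moreover have "\<forall>\<^sub>F u in nhds s. E h2 u = h2 u"
      by (rule eventually_nhds_in_open[of "ball 0 1", THEN eventually_mono]) (use True in \<open>auto simp: E_def\<close>)
    ultimately show ?thesis using isCont_cong by blast
  next
    case False
    have o: "open {s::real. b < \<bar>s\<bar>}" by (intro open_Collect_less continuous_intros)
    have "\<forall>\<^sub>F u in nhds s. E h2 u = 0"
      by (rule eventually_nhds_in_open[OF o, THEN eventually_mono])
        (use False ab in \<open>auto simp: E_def h2_def zero\<close>)
    then show ?thesis using isCont_cong[of "E h2" "\<lambda>_. 0"] by auto
  qed
  show ?thesis
  proof (rule that)
    show "C2_real (E h) (E h1) (E h2)"
      using d d1 c2 by (auto simp: C2_real_def continuous_on_eq_continuous_at)
    show "E h s = F s \<and> E h1 s = F1 s \<and> E h2 s = F2 s" if "\<bar>s\<bar> \<le> a" for s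
      using one[OF that] that ab by (simp add: E_def h_def h1_def h2_def)
    show "E h s = 0" if "\<bar>s\<bar> \<ge> b" for s
      using zero[OF that] by (simp add: E_def h_def)
  qed
qed

section \<open>The Laplace--Beltrami operator on solid polynomials times radial functions\<close>

lemma partial_deriv_eq:
  "(f has_derivative f') (at y) \<Longrightarrow> partial_deriv i f y = f' (axis i 1)"
  using frechet_derivative_at[of f f' y] by (simp add: partial_deriv_def)

lemma C1_funI:
  assumes "\<And>y. (f has_derivative f' y) (at y)"
    and "\<And>i. continuous_on UNIV (\<lambda>y. f' y (axis i 1))"
  shows "C1_fun f"
proof -
  have "partial_deriv i f = (\<lambda>y. f' y (axis i 1))" for i
    using partial_deriv_eq[OF assms(1)] by blast
  then show ?thesis using assms by (auto simp: C1_fun_def differentiable_def)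
qed

definition solid_radial ::
    "real \<Rightarrow> nat \<Rightarrow> real ^ 'n \<Rightarrow> (real \<Rightarrow> real) \<Rightarrow> real ^ 'n \<Rightarrow> real" where
  "solid_radial v k e g y = solid v 0 k (e \<bullet> y) (y \<bullet> y) * g (y \<bullet> y)"

lemma has_derivative_solid_inner:
  "((\<lambda>y. solid v j k (e \<bullet> y) (y \<bullet> y)) has_derivative
     (\<lambda>h. 2 * v * solid (v + 1) (j + 1) k (e \<bullet> y) (y \<bullet> y) * (e \<bullet> h)
       - 2 * v * solid (v + 1) (j + 2) k (e \<bullet> y) (y \<bullet> y) * (y \<bullet> h))) (at (y :: real ^ 'n))"
  by (rule derivative_eq_intros refl)+ (auto simp: inner_commute)

lemma has_derivative_radial:
  assumes "\<And>s. (g has_real_derivative g' s) (at s)"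
  shows "((\<lambda>y. g (y \<bullet> y)) has_derivative (\<lambda>h. 2 * g' (y \<bullet> y) * (y \<bullet> h))) (at (y :: real ^ 'n))"
proof -
  have "((\<lambda>y. y \<bullet> y) has_derivative (\<lambda>h. 2 * (y \<bullet> h))) (at y)"
    by (rule derivative_eq_intros refl)+ (auto simp: inner_commute)
  from DERIV_compose_FDERIV[OF assms this] show ?thesis by (simp add: mult_ac)
qed

lemma continuous_on_solid_inner [continuous_intros]:
  "continuous_on A (\<lambda>y :: real ^ 'n. solid v j k (e \<bullet> y) (y \<bullet> y))"
  by (intro continuous_at_imp_continuous_on ballI has_derivative_continuous[OF has_derivative_solid_inner])

text \<open>The chain rule for a function of \<open>e \<bullet> y\<close> and \<open>|y|\<^sup>2\<close>. The second derivative is sorted by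
  \<open>e\<^sub>i\<^sup>2\<close>, \<open>e\<^sub>i y\<^sub>i\<close> and \<open>y\<^sub>i\<^sup>2\<close>, which sum to \<open>1\<close>, \<open>e \<bullet> y\<close> and \<open>|y|\<^sup>2\<close> over all \<open>i\<close>.\<close>

lemma
  fixes e :: "real ^ 'n"
  assumes g: "C2_real g g1 g2"
  shows partial_deriv_solid_radial: "partial_deriv i (solid_radial v k e g) = (\<lambda>y.
      2 * v * (solid (v + 1) 1 k (e \<bullet> y) (y \<bullet> y) * e $ i
         - solid (v + 1) 2 k (e \<bullet> y) (y \<bullet> y) * y $ i) * g (y \<bullet> y)
      + 2 * solid v 0 k (e \<bullet> y) (y \<bullet> y) * g1 (y \<bullet> y) * y $ i)"
    and partial_deriv2_solid_radial:
     "partial_deriv i (partial_deriv i (solid_radial v k e g)) y =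
        (e $ i)\<^sup>2 * (4 * v * (v + 1) * solid (v + 2) 2 k (e \<bullet> y) (y \<bullet> y) * g (y \<bullet> y))
        + e $ i * y $ i * (8 * v * solid (v + 1) 1 k (e \<bullet> y) (y \<bullet> y) * g1 (y \<bullet> y)
           - 8 * v * (v + 1) * solid (v + 2) 3 k (e \<bullet> y) (y \<bullet> y) * g (y \<bullet> y))
        + (y $ i)\<^sup>2 * (4 * v * (v + 1) * solid (v + 2) 4 k (e \<bullet> y) (y \<bullet> y) * g (y \<bullet> y)
           - 8 * v * solid (v + 1) 2 k (e \<bullet> y) (y \<bullet> y) * g1 (y \<bullet> y)
           + 4 * solid v 0 k (e \<bullet> y) (y \<bullet> y) * g2 (y \<bullet> y))
        + (2 * solid v 0 k (e \<bullet> y) (y \<bullet> y) * g1 (y \<bullet> y)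
           - 2 * v * solid (v + 1) 2 k (e \<bullet> y) (y \<bullet> y) * g (y \<bullet> y))"
    and C2_fun_solid_radial: "C2_fun (solid_radial v k e g)"
proof -
  define p where "p = (\<lambda>m j (y :: real ^ 'n). solid (v + m) j k (e \<bullet> y) (y \<bullet> y))"
  define q where "q = (\<lambda>g (y :: real ^ 'n). g (y \<bullet> y :: real) :: real)"
  have vm: "v + m + 1 = v + (m + 1)" for m by simp
  have dp: "(p m j has_derivative (\<lambda>h. 2 * (v + m) * p (m + 1) (j + 1) y * (e \<bullet> h)
       - 2 * (v + m) * p (m + 1) (j + 2) y * (y \<bullet> h))) (at y)" for m j y
    unfolding p_def vm[symmetric] by (rule has_derivative_solid_inner)
  have dg: "(q g has_derivative (\<lambda>h. 2 * q g1 y * (y \<bullet> h))) (at y)"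
    "(q g1 has_derivative (\<lambda>h. 2 * q g2 y * (y \<bullet> h))) (at y)" for y
    using g unfolding q_def C2_real_def by (auto intro!: has_derivative_radial)
  have cp: "continuous_on A (p m j)" for A m j
    unfolding p_def by (intro continuous_intros)
  have cq: "continuous_on A (q g)" "continuous_on A (q g1)" for A
    by (intro continuous_at_imp_continuous_on ballI has_derivative_continuous[OF dg(1)]
       has_derivative_continuous[OF dg(2)])+
  have cq2: "continuous_on A (q g2)" for A
    unfolding q_def
    by (rule continuous_on_compose2[where t = UNIV and f = "\<lambda>y. y \<bullet> y"])
       (use g in \<open>auto simp: C2_real_def intro!: continuous_intros\<close>)
  have f: "solid_radial v k e g = (\<lambda>y. p 0 0 y * q g y)"
    by (simp add: fun_eq_iff solid_radial_def p_def q_def)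
  define D where "D = (\<lambda>i (y :: real ^ 'n). 2 * v * (p 1 1 y * e $ i - p 1 2 y * y $ i) * q g y
      + 2 * p 0 0 y * q g1 y * y $ i)"
  have dc: "((\<lambda>y. y $ i) has_derivative (\<lambda>h. h $ i)) (at (y :: real ^ 'n))" for i y
    by (rule bounded_linear.has_derivative[OF bounded_linear_vec_nth has_derivative_ident])
  have df: "(solid_radial v k e g has_derivative (\<lambda>h.
      p 0 0 y * (2 * q g1 y * (y \<bullet> h)) + (2 * v * p 1 1 y * (e \<bullet> h)
       - 2 * v * p 1 2 y * (y \<bullet> h)) * q g y)) (at y)" for y
    unfolding f using has_derivative_mult[OF dp[of 0 0 y] dg(1)] by (simp add: numeral_2_eq_2)
  have pd: "partial_deriv i (solid_radial v k e g) = D i" for i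
    by (rule ext) (simp add: partial_deriv_eq[OF df] D_def inner_axis algebra_simps)
  show "partial_deriv i (solid_radial v k e g) = (\<lambda>y.
      2 * v * (solid (v + 1) 1 k (e \<bullet> y) (y \<bullet> y) * e $ i
         - solid (v + 1) 2 k (e \<bullet> y) (y \<bullet> y) * y $ i) * g (y \<bullet> y)
      + 2 * solid v 0 k (e \<bullet> y) (y \<bullet> y) * g1 (y \<bullet> y) * y $ i)"
    unfolding pd D_def p_def q_def by simp
  define D2 where "D2 = (\<lambda>i (y :: real ^ 'n) h. 
      2 * v * (p 1 1 y * e $ i - p 1 2 y * y $ i) * (2 * q g1 y * (y \<bullet> h))
     + 2 * v * ((2 * (v + 1) * p 2 2 y * (e \<bullet> h) - 2 * (v + 1) * p 2 3 y * (y \<bullet> h)) * e $ i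
        - (p 1 2 y * h $ i
           + (2 * (v + 1) * p 2 3 y * (e \<bullet> h) - 2 * (v + 1) * p 2 4 y * (y \<bullet> h)) * y $ i)) * q g y
     + (2 * p 0 0 y * q g1 y * h $ i
       + (2 * p 0 0 y * (2 * q g2 y * (y \<bullet> h))
         + 2 * (2 * v * p 1 1 y * (e \<bullet> h) - 2 * v * p 1 2 y * (y \<bullet> h)) * q g1 y) * y $ i))"
  have dD: "(D i has_derivative D2 i y) (at y)" for i y
    unfolding D_def
    by (rule derivative_eq_intros dp dg dc refl)+
       (auto simp: D2_def numeral_2_eq_2 numeral_3_eq_3 eval_nat_numeral)
  show "partial_deriv i (partial_deriv i (solid_radial v k e g)) y =
        (e $ i)\<^sup>2 * (4 * v * (v + 1) * solid (v + 2) 2 k (e \<bullet> y) (y \<bullet> y) * g (y \<bullet> y))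
        + e $ i * y $ i * (8 * v * solid (v + 1) 1 k (e \<bullet> y) (y \<bullet> y) * g1 (y \<bullet> y)
           - 8 * v * (v + 1) * solid (v + 2) 3 k (e \<bullet> y) (y \<bullet> y) * g (y \<bullet> y))
        + (y $ i)\<^sup>2 * (4 * v * (v + 1) * solid (v + 2) 4 k (e \<bullet> y) (y \<bullet> y) * g (y \<bullet> y)
           - 8 * v * solid (v + 1) 2 k (e \<bullet> y) (y \<bullet> y) * g1 (y \<bullet> y)
           + 4 * solid v 0 k (e \<bullet> y) (y \<bullet> y) * g2 (y \<bullet> y))
        + (2 * solid v 0 k (e \<bullet> y) (y \<bullet> y) * g1 (y \<bullet> y)
           - 2 * v * solid (v + 1) 2 k (e \<bullet> y) (y \<bullet> y) * g (y \<bullet> y))"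
  proof -
    have pq: "solid (v + 2) j k (e \<bullet> y) (y \<bullet> y) = p 2 j y"
      "solid (v + 1) j k (e \<bullet> y) (y \<bullet> y) = p 1 j y"
      "solid v j k (e \<bullet> y) (y \<bullet> y) = p 0 j y" "g (y \<bullet> y) = q g y" "g1 (y \<bullet> y) = q g1 y"
      "g2 (y \<bullet> y) = q g2 y" for j by (simp_all add: p_def q_def)
    show ?thesis unfolding pd partial_deriv_eq[OF dD] D2_def pq
      by (simp add: inner_axis power2_eq_square algebra_simps)
  qed
  have "C1_fun (D i)" for i
  proof (rule C1_funI[OF dD])
    show "continuous_on UNIV (\<lambda>y. D2 i y (axis j 1))" for j
      unfolding D2_def by (intro continuous_intros cp cq cq2)
  qed
  moreover have "C1_fun (solid_radial v k e g)"
    by (rule C1_funI[OF df]) (intro continuous_intros cp cq cq2)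
  ultimately show "C2_fun (solid_radial v k e g)"
    by (simp add: C2_fun_def pd)
qed

text \<open>In the Euclidean Laplacian, the terms that contain \<open>g\<close> itself contract by \<open>solid_contract\<close> to
  \<open>4 v (v + 1) - 2 v n\<close> times one solid polynomial, and this number is zero because
  \<open>n = 2 (v + 1)\<close>. That is harmonicity of the polynomial factor. In the cross terms and in the
  radial derivative, Euler's identity produces the factor \<open>k\<close>.\<close>

lemma hyperbolic_laplacian_solid_radial:
  fixes e y :: "real ^ 'n"
  assumes g: "C2_real g g1 g2" and e: "norm e = 1" and v: "v = (real CARD('n) - 2) / 2"
  defines "s \<equiv> (norm y)\<^sup>2" and "N \<equiv> real CARD('n)"
  shows "hyperbolic_laplacian (solid_radial v k e g) y = solid v 0 k (e \<bullet> y) s *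
     ((1 - s)\<^sup>2 * (4 * s * g2 s + (2 * N + 4 * real k) * g1 s)
      + 2 * (N - 2) * (1 - s) * (k * g s + 2 * s * g1 s))"
proof -
  define t where "t = e \<bullet> y"
  have s: "y \<bullet> y = s" by (simp add: s_def power2_norm_eq_inner)
  have ee: "(\<Sum>i\<in>UNIV. (e $ i)\<^sup>2) = 1"
    using e by (simp add: norm_eq_1 inner_vec_def power2_eq_square)
  have ey: "(\<Sum>i\<in>UNIV. e $ i * y $ i) = t" by (simp add: t_def inner_vec_def)
  have yy: "(\<Sum>i\<in>UNIV. (y $ i)\<^sup>2) = s" by (simp add: s[symmetric] inner_vec_def power2_eq_square)
  let ?p0 = "solid v 0 k t s" and ?p1 = "\<lambda>j. solid (v + 1) j k t s" and ?p2 = "\<lambda>j. solid (v + 2) j k t s"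
  have c: "?p2 2 - 2 * t * ?p2 3 + s * ?p2 4 = ?p1 2"
    using solid_contract[of "v + 1" 2 k t s] by (simp add: add.assoc eval_nat_numeral)
  have eu: "2 * v * (t * ?p1 1 - s * ?p1 2) = k * ?p0" by (rule solid_euler)
  have N: "N = 2 * (v + 1)" by (simp add: v N_def field_simps)
  have "(\<Sum>i\<in>UNIV. partial_deriv i (partial_deriv i (solid_radial v k e g)) y) =
      1 * (4 * v * (v + 1) * ?p2 2 * g s)
      + t * (8 * v * ?p1 1 * g1 s - 8 * v * (v + 1) * ?p2 3 * g s)
      + s * (4 * v * (v + 1) * ?p2 4 * g s - 8 * v * ?p1 2 * g1 s + 4 * ?p0 * g2 s)
      + N * (2 * ?p0 * g1 s - 2 * v * ?p1 2 * g s)"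
    unfolding partial_deriv2_solid_radial[OF g] sum.distrib sum_distrib_right[symmetric] ee ey yy
      sum_constant N_def s t_def[symmetric] by simp
  also have "\<dots> = 4 * v * (v + 1) * g s * (?p2 2 - 2 * t * ?p2 3 + s * ?p2 4)
      + 4 * g1 s * (2 * v * (t * ?p1 1 - s * ?p1 2)) + 4 * s * ?p0 * g2 s
      + N * (2 * ?p0 * g1 s) - 2 * v * N * ?p1 2 * g s"
    by (simp add: algebra_simps)
  also have "\<dots> = ?p0 * (4 * s * g2 s + (2 * N + 4 * real k) * g1 s)"
    unfolding c eu unfolding N by (simp add: algebra_simps)
  finally have lap: "(\<Sum>i\<in>UNIV. partial_deriv i (partial_deriv i (solid_radial v k e g)) y) = \<dots>" .
  have "(\<Sum>i\<in>UNIV. y $ i * partial_deriv i (solid_radial v k e g) y) =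
     (\<Sum>i\<in>UNIV. (e $ i * y $ i) * (2 * v * ?p1 1 * g s) 
       + (y $ i)\<^sup>2 * (2 * ?p0 * g1 s - 2 * v * ?p1 2 * g s))"
    unfolding partial_deriv_solid_radial[OF g] s t_def[symmetric]
    by (intro sum.cong refl) (simp add: algebra_simps power2_eq_square)
  also have "\<dots> = t * (2 * v * ?p1 1 * g s) + s * (2 * ?p0 * g1 s - 2 * v * ?p1 2 * g s)"
    unfolding sum.distrib sum_distrib_right[symmetric] ey yy ..
  also have "\<dots> = (2 * v * (t * ?p1 1 - s * ?p1 2)) * g s + 2 * s * ?p0 * g1 s"
    by (simp add: algebra_simps)
  also have "\<dots> = ?p0 * (k * g s + 2 * s * g1 s)"
    unfolding eu by (simp add: algebra_simps)
  finally have rad: "(\<Sum>i\<in>UNIV. y $ i * partial_deriv i (solid_radial v k e g) y) = \<dots>" .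
  show ?thesis
    unfolding hyperbolic_laplacian_def lap rad s_def[symmetric] N_def[symmetric] t_def[symmetric]
    by (simp add: algebra_simps)
qed

lemma support_solid_radial:
  assumes "\<And>s. \<bar>s\<bar> \<ge> b \<Longrightarrow> g s = 0" and "b < 1"
  shows "closure {y. solid_radial v k e g y \<noteq> 0} \<subseteq> ball 0 1"
proof -
  have "{y. solid_radial v k e g y \<noteq> 0} \<subseteq> {y. y \<bullet> y \<le> b}"
    using assms by (force simp: solid_radial_def)
  moreover have "closed {y :: real ^ 'a. y \<bullet> y \<le> b}"
    by (intro closed_Collect_le continuous_intros)
  ultimately have "closure {y. solid_radial v k e g y \<noteq> 0} \<subseteq> {y. y \<bullet> y \<le> b}"
    by (rule closure_minimal)
  also have "\<dots> \<subseteq> ball 0 1"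
    using assms(2) by (auto simp: norm_eq_sqrt_inner)
  finally show ?thesis .
qed

section \<open>Optional stopping\<close>

lemma subalgebra_past:
  assumes "\<And>t. t \<ge> 0 \<Longrightarrow> X t \<in> borel_measurable M"
  shows "subalgebra M (past M X t)"
proof -
  have "sigma_sets (space M) {X s -` A \<inter> space M | s A. 0 \<le> s \<and> s \<le> t \<and> A \<in> sets borel} \<subseteq> sets M"
    by (rule sets.sigma_sets_subset) (use assms in \<open>auto intro: measurable_sets\<close>)
  moreover have "sets (past M X t)
     = sigma_sets (space M) {X s -` A \<inter> space M | s A. 0 \<le> s \<and> s \<le> t \<and> A \<in> sets borel}"
    unfolding past_def by (rule sets_measure_of) auto
  moreover have "space (past M X t) = space M"
    unfolding past_def by (rule space_measure_of) auto
  ultimately show ?thesis by (simp add: subalgebra_def)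
qed

lemma space_past [simp]: "space (past M X t) = space M"
  unfolding past_def by (rule space_measure_of) auto

lemma preimage_in_past:
  assumes "0 \<le> s" "s \<le> t" "A \<in> sets borel"
  shows "X s -` A \<inter> space M \<in> sets (past M X t)"
  unfolding past_def by (subst sets_measure_of) (use assms in auto)

lemma sets_past_mono:
  assumes "s \<le> t"
  shows "sets (past M X s) \<subseteq> sets (past M X t)"
proof -
  have "sigma_sets (space M) {X u -` A \<inter> space M | u A. 0 \<le> u \<and> u \<le> s \<and> A \<in> sets borel}
      \<subseteq> sigma_sets (space M) {X u -` A \<inter> space M | u A. 0 \<le> u \<and> u \<le> t \<and> A \<in> sets borel}"
    by (rule sigma_sets_mono') (use assms in force)
  then show ?thesis unfolding past_def by (subst (1 2) sets_measure_of) auto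
qed

lemma martingale_set_integral:
  assumes "prob_space M" and X: "\<And>t. t \<ge> 0 \<Longrightarrow> X t \<in> borel_measurable M"
    and N: "martingale_wrt_past M X N" and st: "0 \<le> s" "s \<le> t" and A: "A \<in> sets (past M X s)"
  shows "(LINT \<omega>:A|M. N t \<omega>) = (LINT \<omega>:A|M. N s \<omega>)"
proof -
  interpret prob_space M by fact
  have sub: "subalgebra M (past M X s)" by (rule subalgebra_past[OF X])
  interpret finite_measure_subalgebra M "past M X s"
    by unfold_locales (rule sub)
  have int: "integrable M (N t)" "integrable M (N s)"
    using N st by (auto simp: martingale_wrt_past_def)
  have AM: "A \<in> sets M" using A sub by (auto simp: subalgebra_def)
  have "(LINT \<omega>:A|M. N t \<omega>) = (LINT \<omega>:A|M. real_cond_exp M (past M X s) (N t) \<omega>)"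
    by (rule real_cond_exp_intA[OF int(1) A])
  also have "\<dots> = (LINT \<omega>:A|M. N s \<omega>)"
  proof (rule set_lebesgue_integral_cong_AE[OF AM])
    have "AE \<omega> in M. real_cond_exp M (past M X s) (N t) \<omega> = N s \<omega>"
      using N st by (simp add: martingale_wrt_past_def)
    then show "AE \<omega>\<in>A in M. real_cond_exp M (past M X s) (N t) \<omega> = N s \<omega>"
      by (rule eventually_mono) simp
    show "real_cond_exp M (past M X s) (N t) \<in> borel_measurable M" by simp
    show "N s \<in> borel_measurable M" using int by auto
  qed
  finally show ?thesis .
qed

lemma martingale_wrt_past_cong:
  assumes M: "prob_space M" and X: "\<And>t. t \<ge> 0 \<Longrightarrow> X t \<in> borel_measurable M"
    and N: "martingale_wrt_past M X N"
    and eq: "\<And>t \<omega>. t \<ge> 0 \<Longrightarrow> \<omega> \<in> space M \<Longrightarrow> N t \<omega> = N' t \<omega>"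
  shows "martingale_wrt_past M X N'"
proof -
  interpret prob_space M by (rule M)
  have N_t: "integrable M (N t)" "N t \<in> borel_measurable (past M X t)" if "t \<ge> 0" for t
    using N that by (auto simp: martingale_wrt_past_def)
  have N'_t: "integrable M (N' t)" "N' t \<in> borel_measurable (past M X t)" if "t \<ge> 0" for t
    using N_t[OF that] eq[OF that]
      Bochner_Integration.integrable_cong[OF refl, of M "N t" "N' t"]
      measurable_cong[of "past M X t" "N t" "N' t"] by auto
  show ?thesis
    unfolding martingale_wrt_past_def
  proof (intro conjI allI impI N'_t)
    fix s t :: real assume st: "0 \<le> s \<and> s \<le> t"
    then have t: "0 \<le> t" by simp
    interpret finite_measure_subalgebra M "past M X s"
      by unfold_locales (rule subalgebra_past[OF X])
    have "AE \<omega> in M. real_cond_exp M (past M X s) (N t) \<omega> = N s \<omega>"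
      using N st by (auto simp: martingale_wrt_past_def)
    moreover have "AE \<omega> in M. real_cond_exp M (past M X s) (N t) \<omega>
        = real_cond_exp M (past M X s) (N' t) \<omega>"
      by (rule real_cond_exp_cong) (use N_t(1)[OF t] N'_t(1)[OF t] eq[OF t] in auto)
    ultimately show "AE \<omega> in M. real_cond_exp M (past M X s) (N' t) \<omega> = N' s \<omega>"
      using AE_space by eventually_elim (use st eq in auto)
  qed auto
qed

lemma ceiling_grid_bounds:
  fixes u d :: real
  assumes "0 \<le> u" "0 < d"
  shows "u \<le> real (nat \<lceil>u / d\<rceil>) * d" and "real (nat \<lceil>u / d\<rceil>) * d < u + d"
    and "nat \<lceil>u / d\<rceil> \<le> j \<longleftrightarrow> u \<le> real j * d"
proof -
  have "0 \<le> \<lceil>u / d\<rceil>" using assms by (simp add: order_less_le_trans[of "-1" 0])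
  then have eq: "real (nat \<lceil>u / d\<rceil>) = of_int \<lceil>u / d\<rceil>" by simp
  have "u / d \<le> of_int \<lceil>u / d\<rceil>" "of_int \<lceil>u / d\<rceil> < u / d + 1" by linarith+
  moreover from this(1) have "u \<le> of_int \<lceil>u / d\<rceil> * d"
    using assms(2) by (rule pos_divide_le_eq[THEN iffD1, rotated])
  ultimately show "u \<le> real (nat \<lceil>u / d\<rceil>) * d" "real (nat \<lceil>u / d\<rceil>) * d < u + d"
    unfolding eq using assms by (auto simp: field_simps)
  have "nat \<lceil>u / d\<rceil> \<le> j \<longleftrightarrow> u / d \<le> real j"
    by (simp add: nat_le_iff ceiling_le_iff)
  then show "nat \<lceil>u / d\<rceil> \<le> j \<longleftrightarrow> u \<le> real j * d"
    using assms by (simp add: field_simps)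
qed

text \<open>Rounding up to the next multiple of \<open>T / (m + 1)\<close>.\<close>

lemma grid_tendsto:
  assumes "0 \<le> u" and "T > 0"
  shows "(\<lambda>m. real (nat \<lceil>u / (T / real (Suc m))\<rceil>) * (T / real (Suc m))) \<longlonglongrightarrow> u"
proof (rule tendsto_sandwich)
  show "\<forall>\<^sub>F m in sequentially. u \<le> real (nat \<lceil>u / (T / real (Suc m))\<rceil>) * (T / real (Suc m))"
    using assms by (intro always_eventually allI ceiling_grid_bounds(1)) auto
  show "\<forall>\<^sub>F m in sequentially.
      real (nat \<lceil>u / (T / real (Suc m))\<rceil>) * (T / real (Suc m)) \<le> u + T * inverse (real (Suc m))"
  proof (intro always_eventually allI)
    fix m
    have "real (nat \<lceil>u / (T / real (Suc m))\<rceil>) * (T / real (Suc m)) < u + T / real (Suc m)"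
      using assms by (intro ceiling_grid_bounds(2)) auto
    then show "real (nat \<lceil>u / (T / real (Suc m))\<rceil>) * (T / real (Suc m))
        \<le> u + T * inverse (real (Suc m))"
      by (simp only: divide_inverse less_imp_le)
  qed
  have "(\<lambda>m. u + T * inverse (real (Suc m))) \<longlonglongrightarrow> u + T * 0"
    by (intro tendsto_intros LIMSEQ_inverse_real_of_nat)
  then show "(\<lambda>m. u + T * inverse (real (Suc m))) \<longlonglongrightarrow> u" by simp
qed simp

text \<open>After rounding up to a grid, the random time takes countably many values; continuity of the paths
  gives the limit.\<close>

lemma measurable_at_random_time:
  fixes Y :: "real \<Rightarrow> 'a \<Rightarrow> 'b::metric_space"
  assumes Y: "\<And>t. t \<ge> 0 \<Longrightarrow> Y t \<in> borel_measurable M"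
    and cont: "\<And>\<omega>. \<omega> \<in> space M \<Longrightarrow> continuous_on {0..} (\<lambda>t. Y t \<omega>)"
    and \<sigma>: "\<sigma> \<in> borel_measurable M" "\<And>\<omega>. \<omega> \<in> space M \<Longrightarrow> \<sigma> \<omega> \<ge> 0"
  shows "(\<lambda>\<omega>. Y (\<sigma> \<omega>) \<omega>) \<in> borel_measurable M"
proof (rule borel_measurable_LIMSEQ_metric)
  fix m
  define d where "d = 1 / real (Suc m)"
  have "(\<lambda>\<omega>. Y (real j * d) \<omega>) \<in> borel_measurable M" for j
    by (rule Y) (simp add: d_def)
  moreover have "(\<lambda>\<omega>. nat \<lceil>\<sigma> \<omega> / d\<rceil>) \<in> measurable M (count_space UNIV)"
    using \<sigma>(1) by measurable
  ultimately show "(\<lambda>\<omega>. Y (real (nat \<lceil>\<sigma> \<omega> / (1 / real (Suc m))\<rceil>) * (1 / real (Suc m))) \<omega>) \<in> borel_measurable M"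
    unfolding d_def[symmetric] by (rule measurable_compose_countable)
next
  fix \<omega> assume w: "\<omega> \<in> space M"
  show "(\<lambda>m. Y (real (nat \<lceil>\<sigma> \<omega> / (1 / real (Suc m))\<rceil>) * (1 / real (Suc m))) \<omega>) \<longlonglongrightarrow> Y (\<sigma> \<omega>) \<omega>"
  proof (rule continuous_on_tendsto_compose[OF cont[OF w] grid_tendsto])
    show "\<forall>\<^sub>F m in sequentially.
        real (nat \<lceil>\<sigma> \<omega> / (1 / real (Suc m))\<rceil>) * (1 / real (Suc m)) \<in> {0..}"
      by (intro always_eventually allI, unfold atLeast_iff, intro mult_nonneg_nonneg) auto
  qed (use \<sigma>(2)[OF w] in auto)
qed

text \<open>Round \<open>\<sigma>\<close> up to the grid of mesh \<open>T / (m + 1)\<close>. The event that the rounded time is the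
  \<open>j\<close>-th grid point belongs to the past of that point, so on this event the value of \<open>N\<close> may be
  replaced by its value at time \<open>T\<close> under the integral; summation over \<open>j\<close> gives the claim for the
  rounded time. Continuity of the paths and the bound \<open>B\<close> permit the limit \<open>m \<rightarrow> \<infinity>\<close>.\<close>

lemma optional_stopping:
  fixes N :: "real \<Rightarrow> 'a \<Rightarrow> real"
  assumes M: "prob_space M" and X: "\<And>t. t \<ge> 0 \<Longrightarrow> X t \<in> borel_measurable M"
    and mart: "martingale_wrt_past M X N" and T: "T > 0"
    and \<sigma>: "\<And>\<omega>. \<omega> \<in> space M \<Longrightarrow> 0 \<le> \<sigma> \<omega> \<and> \<sigma> \<omega> \<le> T"
    and stop: "\<And>s. s \<ge> 0 \<Longrightarrow> {\<omega> \<in> space M. \<sigma> \<omega> \<le> s} \<in> sets (past M X s)"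
    and cont: "\<And>\<omega>. \<omega> \<in> space M \<Longrightarrow> continuous_on {0..T} (\<lambda>t. N t \<omega>)"
    and bound: "\<And>\<omega> t. \<omega> \<in> space M \<Longrightarrow> 0 \<le> t \<Longrightarrow> t \<le> T \<Longrightarrow> \<bar>N t \<omega>\<bar> \<le> B"
  shows "(\<lambda>\<omega>. N (\<sigma> \<omega>) \<omega>) \<in> borel_measurable M" (is ?meas)
    and "(LINT \<omega>|M. N (\<sigma> \<omega>) \<omega>) = (LINT \<omega>|M. N 0 \<omega>)"
proof -
  interpret prob_space M by fact
  have past_M: "sets (past M X s) \<subseteq> sets M" for s
    using subalgebra_past[OF X] by (auto simp: subalgebra_def)
  have int: "integrable M (N t)" if "t \<ge> 0" for t
    using mart that by (auto simp: martingale_wrt_past_def)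
  have total: "(LINT \<omega>|M. N T \<omega>) = (LINT \<omega>|M. N 0 \<omega>)"
  proof -
    have "space M \<in> sets (past M X 0)" by (metis sets.top space_past)
    from martingale_set_integral[OF M X mart _ _ this, of T] T show ?thesis
      by (simp add: set_integral_space int)
  qed
  define d where "d m = T / real (Suc m)" for m
  have d: "d m > 0" "real (Suc m) * d m = T" for m using T by (auto simp: d_def)
  define J where "J m \<omega> = nat \<lceil>\<sigma> \<omega> / d m\<rceil>" for m \<omega>
  have J_le: "J m \<omega> \<le> j \<longleftrightarrow> \<sigma> \<omega> \<le> real j * d m" if "\<omega> \<in> space M" for m j \<omega>
    unfolding J_def using \<sigma>[OF that] d by (intro ceiling_grid_bounds(3)) auto
  have J_max: "J m \<omega> \<le> Suc m" if "\<omega> \<in> space M" for m \<omega>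
    using J_le[OF that] \<sigma>[OF that] d(2)[of m] by simp
  define S where "S m j = {\<omega> \<in> space M. J m \<omega> = j}" for m j
  have S_past: "S m j \<in> sets (past M X (real j * d m))" for m j
  proof (cases j)
    case 0
    have "S m 0 = {\<omega> \<in> space M. \<sigma> \<omega> \<le> 0}" using J_le[of _ m 0] by (auto simp: S_def)
    then show ?thesis using stop[of 0] 0 by simp
  next
    case (Suc i)
    have "S m j = {\<omega> \<in> space M. J m \<omega> \<le> j} - {\<omega> \<in> space M. J m \<omega> \<le> i}"
      by (auto simp: S_def Suc)
    also have "\<dots> = {\<omega> \<in> space M. \<sigma> \<omega> \<le> real j * d m} - {\<omega> \<in> space M. \<sigma> \<omega> \<le> real i * d m}"
      using J_le by auto
    finally show ?thesis
      using stop[of "real j * d m"] stop[of "real i * d m"] d(1)[of m]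
        sets_past_mono[of "real i * d m" "real j * d m" M X] Suc
      by (auto intro!: sets.Diff)
  qed
  then have S_M [measurable]: "S m j \<in> sets M" for m j using past_M by blast
  have grid_le: "real j * d m \<le> T" if "j \<le> Suc m" for j m
  proof -
    have "real j * d m \<le> real (Suc m) * d m"
      by (rule mult_right_mono) (use that d(1)[of m] in auto)
    then show ?thesis by (simp only: d(2))
  qed
  have split: "(\<Sum>j\<le>Suc m. indicator (S m j) \<omega> * h j) = h (J m \<omega>)" if "\<omega> \<in> space M" for h :: "nat \<Rightarrow> real" and m \<omega>
  proof -
    have "(\<Sum>j\<le>Suc m. indicator (S m j) \<omega> * h j) = (\<Sum>j\<in>{J m \<omega>}. indicator (S m j) \<omega> * h j)"
      using J_max[OF that, of m] by (intro sum.mono_neutral_right) (auto simp: S_def indicator_def)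
    then show ?thesis using that by (simp add: S_def)
  qed
  define V where "V m \<omega> = N (real (J m \<omega>) * d m) \<omega>" for m \<omega>
  have V_split: "V m \<omega> = (\<Sum>j\<le>Suc m. indicator (S m j) \<omega> * N (real j * d m) \<omega>)"
    if "\<omega> \<in> space M" for m \<omega>
    unfolding V_def using split[OF that, of m "\<lambda>j. N (real j * d m) \<omega>"] by simp
  have int_ind: "integrable M (\<lambda>\<omega>. indicator (S m j) \<omega> * N t \<omega>)" if "t \<ge> 0" for m j t
    using integrable_mult_indicator[OF S_M int[OF that]] by simp
  have V_meas: "V m \<in> borel_measurable M" for m
  proof -
    have "(\<lambda>\<omega>. \<Sum>j\<le>Suc m. indicator (S m j) \<omega> * N (real j * d m) \<omega>) \<in> borel_measurable M"
      using d(1)[of m] by (intro borel_measurable_sum borel_measurable_integrable int_ind) auto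
    then show ?thesis using V_split by (subst measurable_cong) auto
  qed
  have V_int: "(LINT \<omega>|M. V m \<omega>) = (LINT \<omega>|M. N T \<omega>)" for m
  proof -
    have "(LINT \<omega>|M. V m \<omega>) = (LINT \<omega>|M. (\<Sum>j\<le>Suc m. indicator (S m j) \<omega> * N (real j * d m) \<omega>))"
      by (rule Bochner_Integration.integral_cong[OF refl V_split])
    also have "\<dots> = (\<Sum>j\<le>Suc m. LINT \<omega>:S m j|M. N (real j * d m) \<omega>)"
      unfolding set_lebesgue_integral_def real_scaleR_def
      by (rule Bochner_Integration.integral_sum) (use d(1)[of m] in \<open>auto intro: int_ind\<close>)
    also have "\<dots> = (\<Sum>j\<le>Suc m. LINT \<omega>:S m j|M. N T \<omega>)"
      using d(1)[of m]
      by (intro sum.cong refl martingale_set_integral[OF M X mart _ _ S_past, symmetric])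
         (auto intro: grid_le)
    also have "\<dots> = (LINT \<omega>|M. (\<Sum>j\<le>Suc m. indicator (S m j) \<omega> * N T \<omega>))"
      unfolding set_lebesgue_integral_def real_scaleR_def
      by (rule Bochner_Integration.integral_sum[symmetric]) (use T in \<open>auto intro: int_ind\<close>)
    also have "\<dots> = (LINT \<omega>|M. N T \<omega>)"
      by (rule Bochner_Integration.integral_cong[OF refl]) (rule split)
    finally show ?thesis .
  qed
  have V_lim: "(\<lambda>m. V m \<omega>) \<longlonglongrightarrow> N (\<sigma> \<omega>) \<omega>" if w: "\<omega> \<in> space M" for \<omega>
  proof -
    have "(\<lambda>m. real (J m \<omega>) * d m) \<longlonglongrightarrow> \<sigma> \<omega>"
      unfolding J_def d_def using \<sigma>[OF w] T by (intro grid_tendsto) auto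
    then show ?thesis unfolding V_def
      using \<sigma>[OF w] d(1) grid_le[OF J_max[OF w]]
      by (intro continuous_on_tendsto_compose[OF cont[OF w]])
         (auto intro!: always_eventually less_imp_le[OF d(1)] mult_nonneg_nonneg)
  qed
  show meas: ?meas
    by (rule borel_measurable_LIMSEQ_real[OF V_lim V_meas])
  have "(\<lambda>m. LINT \<omega>|M. V m \<omega>) \<longlonglongrightarrow> (LINT \<omega>|M. N (\<sigma> \<omega>) \<omega>)"
  proof (rule integral_dominated_convergence[where w = "\<lambda>_. B"])
    show "AE \<omega> in M. norm (V m \<omega>) \<le> B" for m
      unfolding V_def real_norm_def using d(1)[of m]
      by (intro AE_I2 bound grid_le[OF J_max] mult_nonneg_nonneg) auto
  qed (use meas V_meas V_lim in auto)
  then show "(LINT \<omega>|M. N (\<sigma> \<omega>) \<omega>) = (LINT \<omega>|M. N 0 \<omega>)"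
    unfolding V_int total by (simp add: LIMSEQ_const_iff)
qed

section \<open>Exit times\<close>

text \<open>Continuous paths spend a closed set of times outside the ball, so the infimum is attained.\<close>

lemma exit_time_cases:
  assumes cont: "continuous_on {0..} (\<lambda>t. X t \<omega>)"
  obtains (never) "exit_time r X \<omega> = \<infinity>" "\<And>t. t \<ge> 0 \<Longrightarrow> norm (X t \<omega>) < r"
  | (exits) u where "exit_time r X \<omega> = ereal u" "u \<ge> 0" "norm (X u \<omega>) \<ge> r"
      "\<And>t. 0 \<le> t \<Longrightarrow> t < u \<Longrightarrow> norm (X t \<omega>) < r"
proof -
  define K where "K = {t. 0 \<le> t \<and> r \<le> norm (X t \<omega>)}"
  show ?thesis
  proof (cases "K = {}")
    case True
    then have "norm (X t \<omega>) < r" if "t \<ge> 0" for t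
      using that unfolding K_def by (metis (mono_tags, lifting) empty_iff mem_Collect_eq not_le)
    moreover have "exit_time r X \<omega> = \<infinity>"
      using True by (simp add: exit_time_def K_def[symmetric] top_ereal_def)
    ultimately show ?thesis by (rule never[rotated])
  next
    case False
    then obtain b where b: "b \<in> K" by auto
    have "K \<inter> {0..b} = {0..b} \<inter> (\<lambda>t. norm (X t \<omega>)) -` {r..}"
      by (auto simp: K_def)
    also have "closed \<dots>"
      by (rule continuous_closed_preimage)
         (auto intro!: continuous_intros continuous_on_subset[OF cont])
    finally have "compact (K \<inter> {0..b})"
      using compact_Int_closed[OF compact_Icc[of 0 b], of "K \<inter> {0..b}"] by (simp add: Int_absorb1)
    moreover have "K \<inter> {0..b} \<noteq> {}" using b by (auto simp: K_def)
    ultimately obtain u where u: "u \<in> K" "\<And>t. t \<in> K \<inter> {0..b} \<Longrightarrow> u \<le> t" "u \<le> b"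
      by (metis IntE atLeastAtMost_iff compact_attains_inf)
    have le: "u \<le> t" if "t \<in> K" for t using u that by (cases "t \<le> b") (auto simp: K_def)
    have "Inf (ereal ` K) = ereal u"
      by (rule antisym) (use u le in \<open>auto intro!: Inf_lower Inf_greatest\<close>)
    then have "exit_time r X \<omega> = ereal u" by (simp add: exit_time_def K_def)
    then show ?thesis using u le by (intro exits) (force simp: K_def not_le)+
  qed
qed

text \<open>Truncation at \<open>T\<close> yields a bounded real-valued stopping time.\<close>

definition stopped_exit_time :: "real \<Rightarrow> real \<Rightarrow> (real \<Rightarrow> 'a \<Rightarrow> 'b::real_normed_vector) \<Rightarrow> 'a \<Rightarrow> real" where
  "stopped_exit_time T r X \<omega> = real_of_ereal (min (ereal T) (exit_time r X \<omega>))"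

lemma stopped_exit_time:
  assumes cont: "continuous_on {0..} (\<lambda>t. X t \<omega>)" and T: "T > 0"
  shows stopped_exit_time_bounds: "0 \<le> stopped_exit_time T r X \<omega>" "stopped_exit_time T r X \<omega> \<le> T"
    and stopped_exit_time_inside:
      "norm (X 0 \<omega>) < r \<Longrightarrow> 0 \<le> t \<Longrightarrow> t \<le> stopped_exit_time T r X \<omega> \<Longrightarrow> norm (X t \<omega>) \<le> r"
    and stopped_exit_time_le_iff: "0 \<le> s \<Longrightarrow> s < T \<Longrightarrow>
      stopped_exit_time T r X \<omega> \<le> s \<longleftrightarrow> (\<exists>t\<in>{0..s}. r \<le> norm (X t \<omega>))"
    and norm_at_exit_time: "norm (X 0 \<omega>) < r \<Longrightarrow> exit_time r X \<omega> \<noteq> \<infinity> \<Longrightarrow>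
      norm (position_at X (exit_time r X) \<omega>) = r"
    and stopped_exit_time_infinity: "exit_time r X \<omega> = \<infinity> \<Longrightarrow> stopped_exit_time T r X \<omega> = T"
proof -
  have on_sphere: "norm (X u \<omega>) = r" if "u \<ge> 0" "norm (X 0 \<omega>) < r" "norm (X u \<omega>) \<ge> r"
      "\<And>t. 0 \<le> t \<Longrightarrow> t < u \<Longrightarrow> norm (X t \<omega>) < r" for u
  proof -
    have "continuous_on {0..u} (\<lambda>t. norm (X t \<omega>))"
      by (intro continuous_intros continuous_on_subset[OF cont]) auto
    then have "\<exists>t\<ge>0. t \<le> u \<and> norm (X t \<omega>) = r"
      by (intro IVT') (use that in auto)
    then obtain t where "0 \<le> t" "t \<le> u" "norm (X t \<omega>) = r" by blast
    then show ?thesis using that(4)[of t] by (cases "t = u") auto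
  qed
  show "0 \<le> stopped_exit_time T r X \<omega>" "stopped_exit_time T r X \<omega> \<le> T"
    by (cases rule: exit_time_cases[where X = X and \<omega> = \<omega> and r = r, OF cont, case_names never exits]; use T in \<open>auto simp: stopped_exit_time_def min_def\<close>)+
  show "norm (X t \<omega>) \<le> r" if "norm (X 0 \<omega>) < r" "0 \<le> t" "t \<le> stopped_exit_time T r X \<omega>"
  proof (cases rule: exit_time_cases[where X = X and \<omega> = \<omega> and r = r, OF cont, case_names never exits])
    case never
    then show ?thesis using that by (auto intro: less_imp_le)
  next
    case (exits u)
    then have "t \<le> u" using that by (auto simp: stopped_exit_time_def min_def split: if_splits)
    then show ?thesis using exits that on_sphere[of u] by (cases "t = u") (auto intro: less_imp_le)
  qed
  show "stopped_exit_time T r X \<omega> \<le> s \<longleftrightarrow> (\<exists>t\<in>{0..s}. r \<le> norm (X t \<omega>))" if "0 \<le> s" "s < T" for s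
  proof (cases rule: exit_time_cases[where X = X and \<omega> = \<omega> and r = r, OF cont, case_names never exits])
    case never
    then show ?thesis using that by (auto simp: stopped_exit_time_def min_def not_le)
  next
    case (exits u)
    then have "stopped_exit_time T r X \<omega> \<le> s \<longleftrightarrow> u \<le> s"
      using that by (auto simp: stopped_exit_time_def min_def)
    also have "\<dots> \<longleftrightarrow> (\<exists>t\<in>{0..s}. r \<le> norm (X t \<omega>))"
      using exits by (metis atLeastAtMost_iff not_le order_trans)
    finally show ?thesis .
  qed
  show "norm (position_at X (exit_time r X) \<omega>) = r" if "norm (X 0 \<omega>) < r" "exit_time r X \<omega> \<noteq> \<infinity>"
    by (cases rule: exit_time_cases[where X = X and \<omega> = \<omega> and r = r, OF cont, case_names never exits])
       (use that on_sphere in \<open>auto simp: position_at_def\<close>)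
  show "stopped_exit_time T r X \<omega> = T" if "exit_time r X \<omega> = \<infinity>"
    using that by (simp add: stopped_exit_time_def)
qed

text \<open>The supremum of \<open>|X|\<close> over \<open>[0, s]\<close> is attained and can be computed along a countable dense set
  of times, so the event is a countable combination of events at single times.\<close>

lemma hitting_event_in_past:
  fixes X :: "real \<Rightarrow> 'a \<Rightarrow> 'b::real_normed_vector"
  assumes cont: "\<And>\<omega>. \<omega> \<in> space M \<Longrightarrow> continuous_on {0..} (\<lambda>t. X t \<omega>)" and s: "0 \<le> s"
  shows "{\<omega> \<in> space M. \<exists>t\<in>{0..s}. r \<le> norm (X t \<omega>)} \<in> sets (past M X s)"
proof -
  obtain D where D: "countable D" "D \<subseteq> {0..s}" "{0..s} \<subseteq> closure D"
    using separable[of "{0..s}"] by metis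
  define U where "U n q = X q -` {y. r - 1 / real (Suc n) < norm y} \<inter> space M" for n q
  have "{\<omega> \<in> space M. \<exists>t\<in>{0..s}. r \<le> norm (X t \<omega>)} = (\<Inter>n. \<Union>q\<in>D. U n q)"
  proof (intro equalityI subsetI)
    fix \<omega> assume "\<omega> \<in> {\<omega> \<in> space M. \<exists>t\<in>{0..s}. r \<le> norm (X t \<omega>)}"
    then obtain t where w: "\<omega> \<in> space M" and t: "t \<in> {0..s}" "r \<le> norm (X t \<omega>)" by auto
    have c: "continuous_on {0..s} (\<lambda>t. norm (X t \<omega>))"
      by (intro continuous_intros continuous_on_subset[OF cont[OF w]]) auto
    have "\<exists>q\<in>D. \<omega> \<in> U n q" for n
    proof -
      obtain \<delta> where \<delta>: "\<delta> > 0" "\<And>q. q \<in> {0..s} \<Longrightarrow> dist q t < \<delta> \<Longrightarrow>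
          dist (norm (X q \<omega>)) (norm (X t \<omega>)) < 1 / real (Suc n)"
        using c t(1) unfolding continuous_on_iff by (metis of_nat_0_less_iff zero_less_Suc zero_less_divide_1_iff)
      obtain q where q: "q \<in> D" "dist q t < \<delta>"
        using D(3) t(1) \<delta>(1) by (meson closure_approachable subsetD)
      then have "r - 1 / real (Suc n) < norm (X q \<omega>)"
        using \<delta>(2)[of q] D(2) t(2) by (force simp: dist_real_def)
      then show ?thesis using q w by (auto simp: U_def)
    qed
    then show "\<omega> \<in> (\<Inter>n. \<Union>q\<in>D. U n q)" by auto
  next
    fix \<omega> assume *: "\<omega> \<in> (\<Inter>n. \<Union>q\<in>D. U n q)"
    then have w: "\<omega> \<in> space M" by (auto simp: U_def)
    have c: "continuous_on {0..s} (\<lambda>t. norm (X t \<omega>))"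
      by (intro continuous_intros continuous_on_subset[OF cont[OF w]]) auto
    then obtain t where t: "t \<in> {0..s}" "\<And>q. q \<in> {0..s} \<Longrightarrow> norm (X q \<omega>) \<le> norm (X t \<omega>)"
      using continuous_attains_sup[OF compact_Icc _ c] s by force
    have "r - 1 / real (Suc n) \<le> norm (X t \<omega>)" for n
    proof -
      obtain q where "q \<in> D" "\<omega> \<in> U n q" using * by auto
      then show ?thesis using t(2)[of q] D(2) by (force simp: U_def)
    qed
    moreover have "(\<lambda>n. r - 1 / real (Suc n)) \<longlonglongrightarrow> r - 0"
      using LIMSEQ_inverse_real_of_nat by (intro tendsto_intros) (simp add: inverse_eq_divide)
    ultimately have "r - 0 \<le> norm (X t \<omega>)" by (intro LIMSEQ_le_const2) auto
    then show "\<omega> \<in> {\<omega> \<in> space M. \<exists>t\<in>{0..s}. r \<le> norm (X t \<omega>)}" using w t by auto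
  qed
  also have "\<dots> \<in> sets (past M X s)"
  proof -
    have U: "U n q \<in> sets (past M X s)" if "q \<in> D" for n q
    proof -
      have "open {y::'b. r - 1 / real (Suc n) < norm y}"
        by (intro open_Collect_less continuous_intros)
      then show ?thesis
        unfolding U_def using D(2) that by (intro preimage_in_past) auto
    qed
    have "(\<Union>q\<in>D. U n q) \<in> sets (past M X s)" for n
      by (rule sets.countable_UN'[OF D(1)]) (use U in auto)
    then show ?thesis by (intro sets.countable_INT) auto
  qed
  finally show ?thesis .
qed

lemma stopped_exit_time_is_stopping_time:
  fixes X :: "real \<Rightarrow> 'a \<Rightarrow> 'b::real_normed_vector"
  assumes cont: "\<And>\<omega>. \<omega> \<in> space M \<Longrightarrow> continuous_on {0..} (\<lambda>t. X t \<omega>)" and T: "T > 0" and s: "0 \<le> s"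
  shows "{\<omega> \<in> space M. stopped_exit_time T r X \<omega> \<le> s} \<in> sets (past M X s)"
proof (cases "s < T")
  case True
  then have "{\<omega> \<in> space M. stopped_exit_time T r X \<omega> \<le> s}
      = {\<omega> \<in> space M. \<exists>t\<in>{0..s}. r \<le> norm (X t \<omega>)}"
    using stopped_exit_time_le_iff[where X = X, OF cont T s True] by auto
  then show ?thesis using hitting_event_in_past[OF cont s] by simp
next
  case False
  have "stopped_exit_time T r X \<omega> \<le> s" if "\<omega> \<in> space M" for \<omega>
    using stopped_exit_time_bounds(2)[where X = X and r = r, OF cont[OF that] T] False by linarith
  then have "{\<omega> \<in> space M. stopped_exit_time T r X \<omega> \<le> s} = space (past M X s)" by auto
  then show ?thesis by (metis sets.top)
qed

lemma stopped_exit_time_measurable: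
  fixes X :: "real \<Rightarrow> 'a \<Rightarrow> 'b::real_normed_vector"
  assumes X: "\<And>t. t \<ge> 0 \<Longrightarrow> X t \<in> borel_measurable M"
    and cont: "\<And>\<omega>. \<omega> \<in> space M \<Longrightarrow> continuous_on {0..} (\<lambda>t. X t \<omega>)" and T: "T > 0"
  shows "stopped_exit_time T r X \<in> borel_measurable M"
proof (rule borel_measurable_iff_le[THEN iffD2], rule allI)
  fix s
  show "{\<omega> \<in> space M. stopped_exit_time T r X \<omega> \<le> s} \<in> sets M"
  proof (cases "s \<ge> 0")
    case True
    then show ?thesis
      using stopped_exit_time_is_stopping_time[of M X T s r] cont T subalgebra_past[of X M s] X
      by (auto simp: subalgebra_def)
  next
    case False
    have "\<not> stopped_exit_time T r X \<omega> \<le> s" if "\<omega> \<in> space M" for \<omega>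
      using stopped_exit_time_bounds(1)[where X = X and r = r, OF cont[OF that] T] False by linarith
    then have "{\<omega> \<in> space M. stopped_exit_time T r X \<omega> \<le> s} = {}" by auto
    then show ?thesis by (metis sets.empty_sets)
  qed
qed

lemma stopped_exit_time_finite:
  assumes "continuous_on {0..} (\<lambda>t. X t \<omega>)" and "exit_time r X \<omega> \<noteq> \<infinity>"
    and "real_of_ereal (exit_time r X \<omega>) \<le> T"
  shows "stopped_exit_time T r X \<omega> = real_of_ereal (exit_time r X \<omega>)"
  by (cases rule: exit_time_cases[where X = X and \<omega> = \<omega> and r = r, OF assms(1)])
     (use assms in \<open>auto simp: stopped_exit_time_def min_def\<close>)

lemma stopped_exit_time_tendsto:
  assumes "continuous_on {0..} (\<lambda>t. X t \<omega>)" and "exit_time r X \<omega> \<noteq> \<infinity>"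
  shows "\<forall>\<^sub>F n in sequentially.
    stopped_exit_time (real (Suc n)) r X \<omega> = real_of_ereal (exit_time r X \<omega>)"
proof -
  obtain n0 :: nat where "real_of_ereal (exit_time r X \<omega>) \<le> real n0"
    using real_arch_simple by blast
  then have "real_of_ereal (exit_time r X \<omega>) \<le> real (Suc n)" if "n \<ge> n0" for n
    using that by simp
  then show ?thesis
    using stopped_exit_time_finite[OF assms]
    unfolding eventually_sequentially by blast
qed

text \<open>The path never leaves the ball iff its exit times truncated at \<open>1, 2, 3, \<dots>\<close> all equal the
  truncation level. Otherwise these truncated times are eventually constant and equal to the exit
  time, which is thus measurable as a limit.\<close>

lemma
  fixes X :: "real \<Rightarrow> 'a \<Rightarrow> 'b::real_normed_vector"
  assumes X: "\<And>t. t \<ge> 0 \<Longrightarrow> X t \<in> borel_measurable M"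
    and cont: "\<And>\<omega>. \<omega> \<in> space M \<Longrightarrow> continuous_on {0..} (\<lambda>t. X t \<omega>)"
  shows no_exit_event_measurable: "{\<omega> \<in> space M. exit_time r X \<omega> = \<infinity>} \<in> sets M"
    and position_at_exit_measurable: "position_at X (exit_time r X) \<in> borel_measurable M"
proof -
  define \<sigma> where "\<sigma> n = stopped_exit_time (real (Suc n)) r X" for n
  have \<sigma>[measurable]: "\<sigma> n \<in> borel_measurable M" for n
    unfolding \<sigma>_def by (rule stopped_exit_time_measurable[OF X cont]) auto
  have lim: "(\<lambda>n. \<sigma> n \<omega>) \<longlonglongrightarrow> real_of_ereal (exit_time r X \<omega>)"
    and fin: "\<exists>n. \<sigma> n \<omega> \<noteq> real (Suc n)"
    if w: "\<omega> \<in> space M" "exit_time r X \<omega> \<noteq> \<infinity>" for \<omega>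
  proof -
    note ev = stopped_exit_time_tendsto[of X \<omega> r, OF cont[OF w(1)] w(2), folded \<sigma>_def]
    then show l: "(\<lambda>n. \<sigma> n \<omega>) \<longlonglongrightarrow> real_of_ereal (exit_time r X \<omega>)"
      by (rule tendsto_eventually)
    show "\<exists>n. \<sigma> n \<omega> \<noteq> real (Suc n)"
    proof (rule ccontr)
      assume "\<not> ?thesis"
      then obtain m where "\<And>n. n \<ge> m \<Longrightarrow> real (Suc n) = real_of_ereal (exit_time r X \<omega>)"
        using ev by (auto simp: eventually_sequentially)
      from this[of m] this[of "Suc m"] show False by simp
    qed
  qed
  have "{\<omega> \<in> space M. exit_time r X \<omega> = \<infinity>} = {\<omega> \<in> space M. \<forall>n. \<sigma> n \<omega> = real (Suc n)}"
  proof (intro Collect_cong conj_cong refl iffI)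
    fix \<omega> assume "\<omega> \<in> space M" "exit_time r X \<omega> = \<infinity>"
    then show "\<forall>n. \<sigma> n \<omega> = real (Suc n)"
      unfolding \<sigma>_def by (intro allI stopped_exit_time_infinity cont) auto
  qed (use fin in blast)
  also have "\<dots> \<in> sets M" by measurable
  finally show never [measurable]: "{\<omega> \<in> space M. exit_time r X \<omega> = \<infinity>} \<in> sets M" .
  have "(\<lambda>\<omega>. real_of_ereal (exit_time r X \<omega>)) \<in> borel_measurable M"
  proof (rule borel_measurable_LIMSEQ_real)
    show "(\<lambda>\<omega>. if exit_time r X \<omega> = \<infinity> then 0 else \<sigma> n \<omega>) \<in> borel_measurable M" for n
      by (rule measurable_If[OF _ _ never]) auto
    show "(\<lambda>n. if exit_time r X \<omega> = \<infinity> then 0 else \<sigma> n \<omega>) \<longlonglongrightarrow> real_of_ereal (exit_time r X \<omega>)"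
      if "\<omega> \<in> space M" for \<omega>
      by (cases "exit_time r X \<omega> = \<infinity>") (auto intro: lim[OF that])
  qed
  moreover have "real_of_ereal (exit_time r X \<omega>) \<ge> 0" if "\<omega> \<in> space M" for \<omega>
    unfolding exit_time_def by (intro real_of_ereal_pos Inf_greatest) auto
  ultimately show "position_at X (exit_time r X) \<in> borel_measurable M"
    unfolding position_at_def[abs_def] by (intro measurable_at_random_time[where Y = X, OF X cont])
qed

section \<open>Dynkin's formula and almost sure exit\<close>

lemma continuous_on_hyperbolic_laplacian:
  fixes f :: "real ^ 'n \<Rightarrow> real"
  assumes "C2_fun f"
  shows "continuous_on A (hyperbolic_laplacian f)"
proof -
  have "continuous_on UNIV (partial_deriv i f)"
    "continuous_on UNIV (partial_deriv i (partial_deriv i f))" for i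
    using assms by (auto simp: C2_fun_def C1_fun_def)
  then have "continuous_on A (partial_deriv i f)"
    "continuous_on A (partial_deriv i (partial_deriv i f))" for i
    by (meson continuous_on_subset subset_UNIV)+
  then show ?thesis
    unfolding hyperbolic_laplacian_def[abs_def] by (intro continuous_intros)
qed

lemma bounded_on_unit_ball:
  fixes h :: "real ^ 'n \<Rightarrow> real"
  assumes "continuous_on UNIV h"
  obtains B where "B \<ge> 0" "\<And>y. y \<in> ball 0 1 \<Longrightarrow> \<bar>h y\<bar> \<le> B"
proof -
  have "compact (h ` cball 0 1)"
    by (intro compact_continuous_image continuous_on_subset[OF assms]) auto
  then obtain B where "B > 0" "\<And>y. y \<in> cball 0 1 \<Longrightarrow> norm (h y) \<le> B"
    using bounded_pos[THEN iffD1, OF compact_imp_bounded] by (metis image_eqI)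
  then show ?thesis by (intro that[of B]) auto
qed

text \<open>Up to time \<open>T\<close> the martingale of the martingale problem is bounded and continuous, since \<open>f\<close> and
  its image under the generator are bounded on the ball. So optional stopping applies at the
  truncated exit time.\<close>

lemma dynkin_formula:
  fixes r :: real and X :: "real \<Rightarrow> 'a \<Rightarrow> real ^ 'n" and f :: "real ^ 'n \<Rightarrow> real"
  assumes hbm: "hyperbolic_brownian_motion M X x"
    and f: "C2_fun f" "closure {y. f y \<noteq> 0} \<subseteq> ball 0 1" and T: "T > 0"
  defines "\<sigma> \<equiv> stopped_exit_time T r X"
  shows "integrable M (\<lambda>\<omega>. integral {0..\<sigma> \<omega>} (\<lambda>s. hyperbolic_laplacian f (X s \<omega>)))"
    and "(LINT \<omega>|M. f (X (\<sigma> \<omega>) \<omega>)) - f x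
      = (LINT \<omega>|M. integral {0..\<sigma> \<omega>} (\<lambda>s. hyperbolic_laplacian f (X s \<omega>)))"
proof -
  have M: "prob_space M" and X: "\<And>t. t \<ge> 0 \<Longrightarrow> X t \<in> borel_measurable M"
    and cont: "\<And>\<omega>. \<omega> \<in> space M \<Longrightarrow> continuous_on {0..} (\<lambda>t. X t \<omega>)"
    and ball: "\<And>\<omega> t. \<omega> \<in> space M \<Longrightarrow> t \<ge> 0 \<Longrightarrow> X t \<omega> \<in> ball 0 1"
    and start: "AE \<omega> in M. X 0 \<omega> = x"
    using hbm by (auto simp: hyperbolic_brownian_motion_def)
  interpret prob_space M by (rule M)
  define L where "L = hyperbolic_laplacian f"
  define A where "A t \<omega> = integral {0..t} (\<lambda>s. L (X s \<omega>))" for t \<omega>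
  define N where "N t \<omega> = f (X t \<omega>) - f (X 0 \<omega>) - A t \<omega>" for t \<omega>
  have contf: "continuous_on S f" for S
    using f(1) unfolding C2_fun_def C1_fun_def
    by (meson continuous_on_subset differentiable_imp_continuous_on differentiable_on_def
         differentiable_at_withinI subset_UNIV)
  have contL: "continuous_on S L" for S
    unfolding L_def by (rule continuous_on_hyperbolic_laplacian[OF f(1)])
  have cfX: "continuous_on {0..} (\<lambda>t. f (X t \<omega>))" and cLX: "continuous_on {0..} (\<lambda>t. L (X t \<omega>))"
    if "\<omega> \<in> space M" for \<omega>
    using continuous_on_compose2[OF contf[of UNIV] cont[OF that]]
      continuous_on_compose2[OF contL[of UNIV] cont[OF that]] by auto
  have LX_int: "(\<lambda>s. L (X s \<omega>)) integrable_on {0..t}" if "\<omega> \<in> space M" for \<omega> t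
    by (rule integrable_continuous_interval, rule continuous_on_subset[OF cLX[OF that]]) auto
  have A_eq: "(LINT s:{0..t}|lborel. L (X s \<omega>)) = A t \<omega>" if "\<omega> \<in> space M" for \<omega> t
    unfolding A_def
    by (rule set_borel_integral_eq_integral(2), rule borel_integrable_atLeastAtMost')
       (rule continuous_on_subset[OF cLX[OF that]], auto)
  obtain Bf where Bf: "Bf \<ge> 0" "\<And>y. y \<in> ball 0 1 \<Longrightarrow> \<bar>f y\<bar> \<le> Bf"
    using bounded_on_unit_ball[OF contf] by metis
  obtain BL where BL: "BL \<ge> 0" "\<And>y. y \<in> ball 0 1 \<Longrightarrow> \<bar>L y\<bar> \<le> BL"
    using bounded_on_unit_ball[OF contL] by metis
  have A_bound: "\<bar>A t \<omega>\<bar> \<le> BL * T" if "\<omega> \<in> space M" "0 \<le> t" "t \<le> T" for t \<omega>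
  proof -
    have "norm (A t \<omega>) \<le> BL * (t - 0)"
      unfolding A_def
      by (rule integral_bound) (use that BL ball in \<open>auto intro: continuous_on_subset[OF cLX]\<close>)
    also have "\<dots> \<le> BL * T" using that BL(1) by (intro mult_left_mono) auto
    finally show ?thesis by simp
  qed
  have mart: "martingale_wrt_past M X N"
  proof -
    have m: "martingale_wrt_past M X (\<lambda>t \<omega>. f (X t \<omega>) - f (X 0 \<omega>)
          - (LINT s:{0..t}|lborel. hyperbolic_laplacian f (X s \<omega>)))"
      using hbm f by (auto simp: hyperbolic_brownian_motion_def)
    show ?thesis
      by (rule martingale_wrt_past_cong[OF M X m]) (simp_all add: N_def L_def flip: A_eq)
  qed
  have \<sigma>: "0 \<le> \<sigma> \<omega> \<and> \<sigma> \<omega> \<le> T" if "\<omega> \<in> space M" for \<omega>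
    unfolding \<sigma>_def using stopped_exit_time_bounds[where X = X, OF cont[OF that] T] by auto
  have \<sigma>_meas: "\<sigma> \<in> borel_measurable M"
    unfolding \<sigma>_def by (rule stopped_exit_time_measurable[OF X cont T])
  have N_cont: "continuous_on {0..T} (\<lambda>t. N t \<omega>)" if "\<omega> \<in> space M" for \<omega>
    unfolding N_def A_def
    by (intro continuous_intros indefinite_integral_continuous_1 LX_int that
       continuous_on_subset[OF cfX[OF that]]) auto
  have N_bound: "\<bar>N t \<omega>\<bar> \<le> 2 * Bf + BL * T" if "\<omega> \<in> space M" "0 \<le> t" "t \<le> T" for t \<omega>
    using A_bound[OF that] Bf(2)[OF ball[OF that(1,2)]] Bf(2)[OF ball[OF that(1), of 0]]
    unfolding N_def by linarith
  have stop: "{\<omega> \<in> space M. \<sigma> \<omega> \<le> s} \<in> sets (past M X s)" if "s \<ge> 0" for s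
    unfolding \<sigma>_def by (rule stopped_exit_time_is_stopping_time[OF cont T that])
  note os = optional_stopping[OF M X mart T \<sigma> stop N_cont N_bound]
  have fX_meas: "(\<lambda>\<omega>. f (X (\<sigma> \<omega>) \<omega>)) \<in> borel_measurable M"
  proof -
    have "(\<lambda>\<omega>. X (\<sigma> \<omega>) \<omega>) \<in> borel_measurable M"
      by (rule measurable_at_random_time[OF X cont \<sigma>_meas]) (use \<sigma> in auto)
    then show ?thesis
      by (rule measurable_compose[OF _ borel_measurable_continuous_onI[OF contf]])
  qed
  have fX0_meas: "(\<lambda>\<omega>. f (X 0 \<omega>)) \<in> borel_measurable M"
    by (rule measurable_compose[OF X[OF order_refl] borel_measurable_continuous_onI[OF contf]])
  have fX_int: "integrable M (\<lambda>\<omega>. f (X (\<sigma> \<omega>) \<omega>))"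
    by (rule integrable_const_bound[where B = Bf], rule AE_I2, unfold real_norm_def)
       (use \<sigma> in \<open>auto intro!: fX_meas Bf(2) ball simp del: mem_ball\<close>)
  have fX0_int: "integrable M (\<lambda>\<omega>. f (X 0 \<omega>))"
    by (rule integrable_const_bound[where B = Bf], rule AE_I2, unfold real_norm_def)
       (auto intro!: fX0_meas Bf(2) ball simp del: mem_ball)
  have N_int: "integrable M (\<lambda>\<omega>. N (\<sigma> \<omega>) \<omega>)"
    using \<sigma> by (intro integrable_const_bound[where B = "2 * Bf + BL * T"] os(1) AE_I2)
      (auto intro: N_bound)
  have A_N: "integral {0..\<sigma> \<omega>} (\<lambda>s. hyperbolic_laplacian f (X s \<omega>))
      = f (X (\<sigma> \<omega>) \<omega>) - f (X 0 \<omega>) - N (\<sigma> \<omega>) \<omega>" for \<omega>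
    by (simp add: N_def A_def L_def)
  show "integrable M (\<lambda>\<omega>. integral {0..\<sigma> \<omega>} (\<lambda>s. hyperbolic_laplacian f (X s \<omega>)))"
    unfolding A_N by (intro Bochner_Integration.integrable_diff fX_int fX0_int N_int)
  have "(LINT \<omega>|M. N (\<sigma> \<omega>) \<omega>) = 0"
  proof -
    have "(LINT \<omega>|M. N (\<sigma> \<omega>) \<omega>) = (LINT \<omega>|M. N 0 \<omega>)" by (rule os(2))
    then show ?thesis by (simp add: N_def A_def)
  qed
  moreover have "(LINT \<omega>|M. f (X 0 \<omega>)) = f x"
  proof -
    have "(LINT \<omega>|M. f (X 0 \<omega>)) = (LINT \<omega>|M. f x)"
      by (rule integral_cong_AE[OF fX0_meas]) (use start in auto)
    then show ?thesis by (simp add: prob_space)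
  qed
  ultimately show "(LINT \<omega>|M. f (X (\<sigma> \<omega>) \<omega>)) - f x
      = (LINT \<omega>|M. integral {0..\<sigma> \<omega>} (\<lambda>s. hyperbolic_laplacian f (X s \<omega>)))"
    unfolding A_N by (simp add: fX_int fX0_int N_int)
qed


text \<open>On the ball of radius \<open>r\<close> the operator maps \<open>|y|\<^sup>2\<close> to a function that is at least
  \<open>c = 2 n (1 - r\<^sup>2)\<^sup>2\<close>, and \<open>|y|\<^sup>2 \<le> 1\<close>. Dynkin's formula thus bounds \<open>c\<close> times the mean of the
  exit time truncated at \<open>T\<close> by \<open>1\<close>, and with it \<open>c T\<close> times the probability that there is no exit.
  Letting \<open>T\<close> grow shows that this probability is zero.\<close>

lemma exit_time_finite_AE:
  fixes X :: "real \<Rightarrow> 'a \<Rightarrow> real ^ 'n"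
  assumes n: "CARD('n) \<ge> 2" and r: "0 < r" "r < 1" and x: "norm x < r"
    and hbm: "hyperbolic_brownian_motion M X x"
  shows "AE \<omega> in M. exit_time r X \<omega> \<noteq> \<infinity>"
proof -
  have M: "prob_space M" and X: "\<And>t. t \<ge> 0 \<Longrightarrow> X t \<in> borel_measurable M"
    and cont: "\<And>\<omega>. \<omega> \<in> space M \<Longrightarrow> continuous_on {0..} (\<lambda>t. X t \<omega>)"
    and start: "AE \<omega> in M. X 0 \<omega> = x"
    using hbm by (auto simp: hyperbolic_brownian_motion_def)
  interpret prob_space M by (rule M)
  define e :: "real ^ 'n" where "e = axis undefined 1"
  \<comment> \<open>For \<open>k = 0\<close> the solid polynomial is constant, so any unit vector serves to write a radial function.\<close>
  have e: "norm e = 1" by (simp add: e_def)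
  define N where "N = real CARD('n)"
  define v where "v = (N - 2) / 2"
  have r2: "0 \<le> r\<^sup>2" "r\<^sup>2 < 1" using r by (auto simp: power_less_one_iff)
  have ab: "r\<^sup>2 < (1 + r\<^sup>2) / 2" "(1 + r\<^sup>2) / 2 < 1" using r2 by auto
  obtain g g1 g2 where g: "C2_real g g1 g2"
    and g_in: "\<And>s. \<bar>s\<bar> \<le> r\<^sup>2 \<Longrightarrow> g s = s \<and> g1 s = 1 \<and> g2 s = 0"
    and g_out: "\<And>s. \<bar>s\<bar> \<ge> (1 + r\<^sup>2) / 2 \<Longrightarrow> g s = 0"
    using C2_cutoff[where F = "\<lambda>s. s" and ?F1.0 = "\<lambda>_. 1" and ?F2.0 = "\<lambda>_. 0", OF r2(1) ab
        DERIV_ident DERIV_const continuous_const] by blast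
  define f where "f = solid_radial v 0 e g"
  have f: "C2_fun f" "closure {y. f y \<noteq> 0} \<subseteq> ball 0 1"
    unfolding f_def
    by (rule C2_fun_solid_radial[OF g],
        rule support_solid_radial[OF g_out ab(2)])
  have f_in: "f y = (norm y)\<^sup>2" if "norm y \<le> r" for y
    using that g_in[of "(norm y)\<^sup>2"] by (simp add: f_def solid_radial_def power2_norm_eq_inner[symmetric] power_mono)
  define c where "c = 2 * N * (1 - r\<^sup>2)\<^sup>2"
  have c: "c > 0" using r2 n by (simp add: c_def N_def)
  have L_in: "hyperbolic_laplacian f y \<ge> c" if "norm y \<le> r" for y
  proof -
    define s where "s = (norm y)\<^sup>2"
    have s: "0 \<le> s" "s \<le> r\<^sup>2" using that by (auto simp: s_def power_mono)
    have "hyperbolic_laplacian f y = 2 * N * (1 - s)\<^sup>2 + 2 * (N - 2) * (1 - s) * (2 * s)"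
      unfolding f_def hyperbolic_laplacian_solid_radial[OF g e v_def[unfolded N_def]]
      using g_in[of s] s by (simp add: s_def[symmetric] N_def)
    moreover have "2 * N * (1 - s)\<^sup>2 \<ge> c"
      unfolding c_def using s r2 n by (intro mult_left_mono power_mono) (auto simp: N_def)
    moreover have "2 * (N - 2) * (1 - s) * (2 * s) \<ge> 0"
      using s r2 n by (intro mult_nonneg_nonneg) (auto simp: N_def)
    ultimately show ?thesis by linarith
  qed
  define E where "E = {\<omega> \<in> space M. exit_time r X \<omega> = \<infinity>}"
  have E: "E \<in> events" unfolding E_def by (rule no_exit_event_measurable[where X = X, OF X cont])
  have bound: "c * T * prob E \<le> 1" if T: "T > 0" for T
  proof -
    define \<sigma> where "\<sigma> = stopped_exit_time T r X"
    define A where "A \<omega> = integral {0..\<sigma> \<omega>} (\<lambda>s. hyperbolic_laplacian f (X s \<omega>))" for \<omega>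
    note dynkin = dynkin_formula[OF hbm f T, where r = r, folded \<sigma>_def, folded A_def]
    have good: "AE \<omega> in M. \<omega> \<in> space M \<and> norm (X 0 \<omega>) < r"
      using start AE_space by eventually_elim (use x in auto)
    have ind: "integrable M (indicator E :: 'a \<Rightarrow> real)"
      using E by (intro integrable_real_indicator) (auto simp: emeasure_eq_measure)
    have "c * T * prob E = (LINT \<omega>|M. c * T * indicator E \<omega>)"
      using E sets.sets_into_space[OF E] by (simp add: Int_absorb2)
    also have "\<dots> \<le> (LINT \<omega>|M. A \<omega>)"
    proof (rule integral_mono_AE)
      show "integrable M (\<lambda>\<omega>. c * T * indicator E \<omega>)" by (rule integrable_mult_right[OF ind])
      show "integrable M A" by (rule dynkin(1))
      show "AE \<omega> in M. c * T * indicator E \<omega> \<le> A \<omega>"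
        using good
      proof eventually_elim
        case (elim \<omega>)
        then have w: "\<omega> \<in> space M" and x0: "norm (X 0 \<omega>) < r" by auto
        have \<sigma>0: "0 \<le> \<sigma> \<omega>"
          unfolding \<sigma>_def by (rule stopped_exit_time_bounds(1)[where X = X, OF cont[OF w] T])
        have "continuous_on {0..\<sigma> \<omega>} (\<lambda>s. hyperbolic_laplacian f (X s \<omega>))"
          by (rule continuous_on_compose2[OF continuous_on_hyperbolic_laplacian[OF f(1), of UNIV]])
             (auto intro: continuous_on_subset[OF cont[OF w]])
        then have "integral {0..\<sigma> \<omega>} (\<lambda>s. c) \<le> A \<omega>"
          unfolding A_def using w x0
          by (intro integral_le integrable_continuous_interval L_in)
             (auto simp: \<sigma>_def intro: stopped_exit_time_inside[where X = X, OF cont[OF w] T])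
        then have "c * \<sigma> \<omega> \<le> A \<omega>" using \<sigma>0 by (simp add: mult.commute)
        moreover have "c * T * indicator E \<omega> \<le> c * \<sigma> \<omega>"
        proof (cases "\<omega> \<in> E")
          case True
          then have "\<sigma> \<omega> = T"
            unfolding \<sigma>_def E_def
            by (intro stopped_exit_time_infinity[where X = X, OF cont[OF w] T]) auto
          then show ?thesis using c T by (simp add: indicator_def)
        next
          case False
          then show ?thesis using c \<sigma>0 by simp
        qed
        ultimately show ?case by simp
      qed
    qed
    also have "\<dots> = (LINT \<omega>|M. f (X (\<sigma> \<omega>) \<omega>)) - f x"
      using dynkin(2) by simp
    also have "\<dots> \<le> 1 - 0"
    proof (rule diff_mono)
      show "0 \<le> f x" using f_in[of x] x by simp
      have "AE \<omega> in M. f (X (\<sigma> \<omega>) \<omega>) \<le> 1"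
        using good
      proof eventually_elim
        case (elim \<omega>)
        then have "norm (X (\<sigma> \<omega>) \<omega>) \<le> r"
          unfolding \<sigma>_def
          by (intro stopped_exit_time_inside[where X = X, OF cont T] order_refl
               stopped_exit_time_bounds(1)[where X = X, OF cont T]) auto
        moreover from this have "(norm (X (\<sigma> \<omega>) \<omega>))\<^sup>2 \<le> r\<^sup>2" by (simp add: power_mono)
        ultimately show ?case using f_in r2 by simp
      qed
      then show "(LINT \<omega>|M. f (X (\<sigma> \<omega>) \<omega>)) \<le> 1"
        by (cases "integrable M (\<lambda>\<omega>. f (X (\<sigma> \<omega>) \<omega>))")
           (auto intro: integral_le_const simp: not_integrable_integral_eq)
    qed
    finally show ?thesis by simp
  qed
  have "prob E = 0"
  proof (rule ccontr)
    assume "prob E \<noteq> 0"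
    then have p: "c * prob E > 0" using c by (simp add: zero_less_measure_iff)
    have "c * (2 / (c * prob E)) * prob E = 2"
      using c \<open>prob E \<noteq> 0\<close> by simp
    moreover have "c * (2 / (c * prob E)) * prob E \<le> 1"
      using p by (intro bound) simp
    ultimately show False by simp
  qed
  then have "AE \<omega> in M. \<omega> \<notin> E" using E by (simp add: prob_eq_0)
  then show ?thesis using AE_space by eventually_elim (auto simp: E_def)
qed

section \<open>Gegenbauer polynomials at the exit position\<close>

theorem theorem3p1:
  fixes M :: "'a measure"
    and X :: "real \<Rightarrow> 'a \<Rightarrow> real ^ 'n"
    and x :: "real ^ 'n"
    and r \<rho> :: real
    and F :: "nat \<Rightarrow> real \<Rightarrow> real"
    and k :: nat
  assumes "CARD('n) > 2"
    and "0 < r" and "r < 1"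
    and "x \<noteq> 0" and "norm x < r"
    and "hyperbolic_brownian_motion M X x"
  defines "\<rho> \<equiv> (real CARD('n) - 2) / 2"
    and "F \<equiv> (\<lambda>k z. gauss_hypergeometric (real k) (- \<rho>) (real k + real CARD('n) / 2) z)"
  shows "(LINT \<omega>|M. gegenbauer \<rho> k (cos_angle x (position_at X (exit_time r X) \<omega>)))
           / gegenbauer \<rho> k 1
         = (norm x / r) ^ k * (F k ((norm x)\<^sup>2) / F k (r\<^sup>2))"
proof -
  note n = assms(1) and r = assms(2,3) and x = assms(4,5) and hbm = assms(6)
  have M: "prob_space M" and X: "\<And>t. t \<ge> 0 \<Longrightarrow> X t \<in> borel_measurable M"
    and cont: "\<And>\<omega>. \<omega> \<in> space M \<Longrightarrow> continuous_on {0..} (\<lambda>t. X t \<omega>)"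
    and ball: "\<And>\<omega> t. \<omega> \<in> space M \<Longrightarrow> t \<ge> 0 \<Longrightarrow> X t \<omega> \<in> ball 0 1"
    and start: "AE \<omega> in M. X 0 \<omega> = x"
    using hbm by (auto simp: hyperbolic_brownian_motion_def)
  interpret prob_space M by (rule M)
  have fin: "AE \<omega> in M. exit_time r X \<omega> \<noteq> \<infinity>"
    by (rule exit_time_finite_AE[OF _ r x(2) hbm]) (use n in simp)
  have good: "AE \<omega> in M. \<omega> \<in> space M \<and> norm (X 0 \<omega>) < r \<and> exit_time r X \<omega> \<noteq> \<infinity>"
    using start AE_space fin
    by eventually_elim (use x n in auto)
  \<comment> \<open>In this direction the cosine of the angle to \<open>x\<close> is \<open>(e \<bullet> y) / |y|\<close>.\<close>
  define e where "e = x /\<^sub>R norm x"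
  have e: "norm e = 1" using x by (simp add: e_def)
  define N where "N = real CARD('n)"
  have \<rho>: "\<rho> = (real CARD('n) - 2) / 2" by (simp add: \<rho>_def)
  define a b c where "a = real k" and "b = - \<rho>" and "c = real k + N / 2"
  have c: "c > 0" using n by (simp add: c_def N_def add_nonneg_pos)
  define H where "H m = hyp_deriv m a b c" for m
  have F_H: "F k = H 0"
    by (simp add: F_def H_def gauss_hypergeometric_eq_hyp_deriv[abs_def] a_def b_def c_def N_def)
  have F_pos: "F k s > 0" if "0 \<le> s" "s < 1" for s
    using radial_hypergeometric_pos[of N s k] that n by (simp add: F_def \<rho>_def N_def)
  have dH: "(H m has_real_derivative H (Suc m) s) (at s)" if "\<bar>s\<bar> < 1" for m s
    unfolding H_def by (rule DERIV_hyp_deriv[OF c that])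
  have dH0: "(H 0 has_real_derivative H 1 s) (at s)"
    and dH1: "(H 1 has_real_derivative H 2 s) (at s)" and cH2: "isCont (H 2) s"
    if "\<bar>s\<bar> < 1" for s
    using dH[OF that, of 0] dH[OF that, of 1] DERIV_isCont[OF dH[OF that, of 2]]
    by (simp_all add: numeral_2_eq_2)
  have r2: "0 \<le> r\<^sup>2" "r\<^sup>2 < 1" using r by (auto simp: power_less_one_iff)
  have ab: "r\<^sup>2 < (1 + r\<^sup>2) / 2" "(1 + r\<^sup>2) / 2 < 1" using r2 by auto
  obtain g g1 g2 where g: "C2_real g g1 g2"
    and g_in: "\<And>s. \<bar>s\<bar> \<le> r\<^sup>2 \<Longrightarrow> g s = H 0 s \<and> g1 s = H 1 s \<and> g2 s = H 2 s"
    and g_out: "\<And>s. \<bar>s\<bar> \<ge> (1 + r\<^sup>2) / 2 \<Longrightarrow> g s = 0"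
    using C2_cutoff[where F = "H 0" and ?F1.0 = "H 1" and ?F2.0 = "H 2", OF r2(1) ab dH0 dH1 cH2]
    by blast
  define f where "f = solid_radial \<rho> k e g"
  have f: "C2_fun f" "closure {y. f y \<noteq> 0} \<subseteq> ball 0 1"
    unfolding f_def
    by (rule C2_fun_solid_radial[OF g],
        rule support_solid_radial[OF g_out ab(2)])
  have f_in: "f y = norm y ^ k * gegenbauer \<rho> k (cos_angle x y) * F k ((norm y)\<^sup>2)"
    if "norm y \<le> r" for y
  proof -
    have "e \<bullet> y = norm y * cos_angle x y"
      using x by (cases "y = 0") (auto simp: e_def cos_angle_def field_simps)
    then have "solid \<rho> 0 k (e \<bullet> y) (y \<bullet> y) = solid \<rho> 0 k (norm y * cos_angle x y) ((norm y)\<^sup>2 * 1)"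
      by (simp add: power2_norm_eq_inner)
    also have "\<dots> = norm y ^ k * gegenbauer \<rho> k (cos_angle x y)"
      unfolding solid_scale gegenbauer_eq_solid ..
    finally show ?thesis
      using that g_in[of "(norm y)\<^sup>2"]
      by (simp add: f_def solid_radial_def power2_norm_eq_inner[symmetric] power_mono F_H)
  qed
  have L_in: "hyperbolic_laplacian f y = 0" if "norm y \<le> r" for y
  proof -
    define s where "s = (norm y)\<^sup>2"
    have s: "0 \<le> s" "s \<le> r\<^sup>2" using that by (auto simp: s_def power_mono)
    have "(1 - s)\<^sup>2 * (4 * s * H 2 s + (2 * N + 4 * real k) * H 1 s)
        + 2 * (N - 2) * (1 - s) * (k * H 0 s + 2 * s * H 1 s)
      = 4 * (1 - s) * (s * (1 - s) * H 2 s + (c - (a + b + 1) * s) * H 1 s - a * b * H 0 s)"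
    proof -
      have N: "N = 2 * \<rho> + 2" and c': "c = k + \<rho> + 1"
        by (auto simp: \<rho>_def N_def c_def field_simps)
      show ?thesis unfolding c' a_def b_def N by algebra
    qed
    also have "\<dots> = 0"
      using hyp_deriv_ode[OF c, of s a b] s r2 by (simp add: H_def)
    finally have zero: "(1 - s)\<^sup>2 * (4 * s * H 2 s + (2 * N + 4 * real k) * H 1 s)
        + 2 * (N - 2) * (1 - s) * (k * H 0 s + 2 * s * H 1 s) = 0" .
    have gs: "g s = H 0 s" "g1 s = H 1 s" "g2 s = H 2 s" using g_in[of s] s by auto
    show ?thesis
      unfolding f_def hyperbolic_laplacian_solid_radial[OF g e \<rho>] s_def[symmetric]
        N_def[symmetric] gs zero by simp
  qed
  have stopped: "(LINT \<omega>|M. f (X (stopped_exit_time T r X \<omega>) \<omega>)) = f x" if T: "T > 0" for T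
  proof -
    define \<sigma> where "\<sigma> = stopped_exit_time T r X"
    note dynkin = dynkin_formula[OF hbm f T, where r = r, folded \<sigma>_def]
    have "(LINT \<omega>|M. integral {0..\<sigma> \<omega>} (\<lambda>s. hyperbolic_laplacian f (X s \<omega>))) = (LINT \<omega>|M. 0)"
    proof (rule integral_cong_AE)
      show "AE \<omega> in M. integral {0..\<sigma> \<omega>} (\<lambda>s. hyperbolic_laplacian f (X s \<omega>)) = 0"
        using good
      proof eventually_elim
        case (elim \<omega>)
        then have "hyperbolic_laplacian f (X s \<omega>) = 0" if "s \<in> {0..\<sigma> \<omega>}" for s
          using that unfolding \<sigma>_def
          by (intro L_in stopped_exit_time_inside[where X = X, OF cont T]) auto
        then have "integral {0..\<sigma> \<omega>} (\<lambda>s. hyperbolic_laplacian f (X s \<omega>)) = integral {0..\<sigma> \<omega>} (\<lambda>s. 0)"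
          by (rule Henstock_Kurzweil_Integration.integral_cong)
        then show ?case by simp
      qed
    qed (use dynkin(1) in auto)
    then show ?thesis using dynkin(2) by (simp add: \<sigma>_def)
  qed
  define Y where "Y = position_at X (exit_time r X)"
  have Y: "Y \<in> borel_measurable M"
    unfolding Y_def by (rule position_at_exit_measurable[OF X cont])
  have contf: "continuous_on UNIV f"
    using f(1) unfolding C2_fun_def C1_fun_def
    by (meson differentiable_imp_continuous_on differentiable_on_def differentiable_at_withinI)
  then obtain B where B: "\<And>y. y \<in> ball 0 1 \<Longrightarrow> \<bar>f y\<bar> \<le> B"
    using bounded_on_unit_ball by metis
  have fY: "(\<lambda>\<omega>. f (Y \<omega>)) \<in> borel_measurable M"
    using borel_measurable_continuous_onI[OF contf] Y by measurable
  have "(\<lambda>m. LINT \<omega>|M. f (X (stopped_exit_time (real (Suc m)) r X \<omega>) \<omega>)) \<longlonglongrightarrow> (LINT \<omega>|M. f (Y \<omega>))"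
  proof (rule integral_dominated_convergence[where w = "\<lambda>_. B", OF fY])
    fix m
    have "(\<lambda>\<omega>. X (stopped_exit_time (real (Suc m)) r X \<omega>) \<omega>) \<in> borel_measurable M"
      by (rule measurable_at_random_time[OF X cont stopped_exit_time_measurable[OF X cont]])
         (auto intro: stopped_exit_time_bounds(1)[where X = X, OF cont])
    then show "(\<lambda>\<omega>. f (X (stopped_exit_time (real (Suc m)) r X \<omega>) \<omega>)) \<in> borel_measurable M"
      using borel_measurable_continuous_onI[OF contf] by measurable
    show "AE \<omega> in M. norm (f (X (stopped_exit_time (real (Suc m)) r X \<omega>) \<omega>)) \<le> B"
      unfolding real_norm_def
      by (intro AE_I2 B ball stopped_exit_time_bounds(1)[where X = X, OF cont]) auto
  next
    show "AE \<omega> in M. (\<lambda>m. f (X (stopped_exit_time (real (Suc m)) r X \<omega>) \<omega>)) \<longlonglongrightarrow> f (Y \<omega>)"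
      using good
    proof eventually_elim
      case (elim \<omega>)
      then have "\<forall>\<^sub>F m in sequentially.
          stopped_exit_time (real (Suc m)) r X \<omega> = real_of_ereal (exit_time r X \<omega>)"
        by (intro stopped_exit_time_tendsto[of X \<omega>] cont) auto
      then have "\<forall>\<^sub>F m in sequentially. f (X (stopped_exit_time (real (Suc m)) r X \<omega>) \<omega>) = f (Y \<omega>)"
        by eventually_elim (simp add: Y_def position_at_def)
      then show ?case by (rule tendsto_eventually)
    qed
  qed auto
  \<comment> \<open>Every term of the convergent sequence equals \<open>f x\<close>.\<close>
  then have mean: "(LINT \<omega>|M. f (Y \<omega>)) = f x"
    by (simp add: stopped LIMSEQ_const_iff)
  have "(LINT \<omega>|M. f (Y \<omega>)) = (LINT \<omega>|M. (r ^ k * F k (r\<^sup>2)) * gegenbauer \<rho> k (cos_angle x (Y \<omega>)))"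
  proof (rule integral_cong_AE[OF fY])
    have "isCont (\<lambda>z. gegenbauer \<rho> k z) z" for z
      unfolding gegenbauer_eq_solid
      by (rule has_derivative_continuous[OF has_derivative_solid[OF has_derivative_ident has_derivative_const]])
    then have "(\<lambda>z. gegenbauer \<rho> k z) \<in> borel_measurable borel"
      by (intro borel_measurable_continuous_onI continuous_at_imp_continuous_on) auto
    moreover have "(\<lambda>\<omega>. cos_angle x (Y \<omega>)) \<in> borel_measurable M"
      unfolding cos_angle_def using Y by measurable
    ultimately show "(\<lambda>\<omega>. (r ^ k * F k (r\<^sup>2)) * gegenbauer \<rho> k (cos_angle x (Y \<omega>))) \<in> borel_measurable M"
      by measurable
    show "AE \<omega> in M. f (Y \<omega>) = (r ^ k * F k (r\<^sup>2)) * gegenbauer \<rho> k (cos_angle x (Y \<omega>))"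
      using good
    proof eventually_elim
      case (elim \<omega>)
      then have "norm (Y \<omega>) = r"
        unfolding Y_def by (intro norm_at_exit_time[where X = X and T = 1] cont) auto
      then show ?case by (simp add: f_in)
    qed
  qed
  moreover have "f x = norm x ^ k * gegenbauer \<rho> k 1 * F k ((norm x)\<^sup>2)"
    using f_in[of x] x by (simp add: cos_angle_def power2_norm_eq_inner[symmetric] power2_eq_square[symmetric])
  ultimately have "(r ^ k * F k (r\<^sup>2)) * (LINT \<omega>|M. gegenbauer \<rho> k (cos_angle x (Y \<omega>)))
      = norm x ^ k * gegenbauer \<rho> k 1 * F k ((norm x)\<^sup>2)"
    using mean by simp
  moreover have "gegenbauer \<rho> k 1 > 0"
    using n by (intro gegenbauer_at_1_pos) (simp add: \<rho>_def)
  ultimately show ?thesis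
    using r F_pos[OF r2] unfolding Y_def by (simp add: field_simps power_divide)
qed

end
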